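(* For every $\omega\in A_n$, $$F^d_\omega(\mathbf x,\mathbf y)=\sum_{T\in E(\omega)} R_{\mathrm{sh}(T)}(\mathbf x,\mathbf y),$$ where $E(\omega)$ is the set of Edelman–Greene tableaux for $\omega$ and $\mathrm{sh}(T)$ is the shape of $T$.
   Context: Let $W$ be the group generated by $s_{-n},\dots,s_{-1},s_0,s_1,\dots,s_n$ subject to $(s_as_b)^{m_{ab}}=1$, where $m_{ab}=1$ if $|a|=|b|$; $m_{ab}=3$ if $a,b\ne 0$ and $\bigl||a|-|b|\bigr|=1$; $m_{ab}=4$ if one of $a,b$ is $0$ and $\bigl||a|-|b|\bigr|=1$; $m_{ab}=2$ if $\bigl||a|-|b|\bigr|>1$. $A_n\subseteq W$ is the subgroup generated by $s_1,\dots,s_n$. A reduced word for $\omega$ is an expression in $s_{-n},\dots,s_n$ of minimal length. $RSIF_k(\omega)$ is the set of reduced words for $\omega$ together with a division into $k$ consecutive (possibly empty) blocks, each strictly increasing for $s_{-n}<\dots<s_0<\dots<s_n$; the double weight $(dw(v,1),dw(v,2))$ records in its $i$-th entries the number of generators with negative, resp. nonnegative, index in the $i$-th block. $F^d_\omega(x,y)=\sum_{v\in RSIF_k(\omega)}x^{dw(v,1)}y^{dw(v,2)}$ with $x=(x_1,\dots,x_k)$, $y=(y_1,\dots,y_k)$, and $F^d_\omega(\mathbf x,\mathbf y)$ is its limit as $k\to\infty$. An Edelman–Greene tableau for $\omega\in A_n$ is a filling of a Young diagram with $s_1,\dots,s_n$, strictly increasing along rows and columns, whose reading word (rows left to right,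 bottom row to top row) is a reduced word for $\omega$. A primed tableau of shape $\lambda/\mu$ over $\{1'<1<\dots<k'<k\}$ is a filling with rows and columns weakly increasing, at most one $i'$ per row and at most one $i$ per column for each $i$; its double weight $(X,Y)$ has $X(i)=\#\{i'\}$, $Y(i)=\#\{i\}$. $R_{\lambda/\mu}(x,y)=\sum_{T}x^{X}y^{Y}$ summed over all primed tableaux of shape $\lambda/\mu$ over this alphabet, and $R_{\lambda/\mu}(\mathbf x,\mathbf y)$ is the limit $k\to\infty$. *)

theory Defs
  imports Main
begin

text \<open>Generators s_a (a in {-n..n}) are encoded by the integer a; words are int lists.\<close>

definition letters :: "nat \<Rightarrow> int set" where
  "letters n = {- int n .. int n}"

definition mexp :: "int \<Rightarrow> int \<Rightarrow> nat" where
  "mexp a b =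
     (if \<bar>a\<bar> = \<bar>b\<bar> then 1
      else if a \<noteq> 0 \<and> b \<noteq> 0 \<and> \<bar>\<bar>a\<bar> - \<bar>b\<bar>\<bar> = 1 then 3
      else if (a = 0 \<or> b = 0) \<and> \<bar>\<bar>a\<bar> - \<bar>b\<bar>\<bar> = 1 then 4
      else 2)"

definition wstep :: "nat \<Rightarrow> int list \<Rightarrow> int list \<Rightarrow> bool" where
  "wstep n x y \<longleftrightarrow> (\<exists>u v a b. set u \<subseteq> letters n \<and> set v \<subseteq> letters n \<and>
      a \<in> letters n \<and> b \<in> letters n \<and>
      x = u @ concat (replicate (mexp a b) [a, b]) @ v \<and> y = u @ v)"

text \<open>Two words represent the same element of W iff they are related by the
  equivalence closure of the relator steps.  Since every generator is an involution
  (m_aa = 1), every element of W is represented by a positive word, so this is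
  exactly the group given by the presentation.\<close>
definition wequiv :: "nat \<Rightarrow> int list \<Rightarrow> int list \<Rightarrow> bool" where
  "wequiv n x y \<longleftrightarrow> set x \<subseteq> letters n \<and> (symclp (wstep n))\<^sup>*\<^sup>* x y"

definition W_elem :: "nat \<Rightarrow> int list \<Rightarrow> int list set" where
  "W_elem n w = {v. wequiv n w v}"

definition in_A :: "nat \<Rightarrow> int list set \<Rightarrow> bool" where
  "in_A n \<omega> \<longleftrightarrow> (\<exists>w. set w \<subseteq> {1 .. int n} \<and> \<omega> = W_elem n w)"

definition reduced_words :: "int list set \<Rightarrow> int list set" where
  "reduced_words \<omega> = {v \<in> \<omega>. \<forall>u\<in>\<omega>. length v \<le> length u}"

definition RSIF :: "nat \<Rightarrow> int list set \<Rightarrow> int list list set" where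
  "RSIF k \<omega> = {bs. length bs = k \<and> (\<forall>b\<in>set bs. sorted_wrt (<) b) \<and>
                    concat bs \<in> reduced_words \<omega>}"

definition dw1 :: "int list list \<Rightarrow> nat \<Rightarrow> nat" where
  "dw1 bs i = (if 1 \<le> i \<and> i \<le> length bs then length (filter (\<lambda>a. a < 0) (bs ! (i - 1))) else 0)"

definition dw2 :: "int list list \<Rightarrow> nat \<Rightarrow> nat" where
  "dw2 bs i = (if 1 \<le> i \<and> i \<le> length bs then length (filter (\<lambda>a. 0 \<le> a) (bs ! (i - 1))) else 0)"

text \<open>F^d_\<omega>(x_1..x_k, y_1..y_k), represented by its coefficient function:
  the coefficient of x^X y^Y.\<close>
definition Fd :: "nat \<Rightarrow> int list set \<Rightarrow> (nat \<Rightarrow> nat) \<times> (nat \<Rightarrow> nat) \<Rightarrow> nat" where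
  "Fd k \<omega> = (\<lambda>(X, Y). card {bs \<in> RSIF k \<omega>. dw1 bs = X \<and> dw2 bs = Y})"

text \<open>Tableaux are lists of rows (English notation, row 0 on top).\<close>
definition young_shape :: "'a list list \<Rightarrow> bool" where
  "young_shape T \<longleftrightarrow> (\<forall>r\<in>set T. r \<noteq> []) \<and> sorted_wrt (\<ge>) (map length T)"

definition shape :: "'a list list \<Rightarrow> nat list" where
  "shape T = map length T"

definition EG :: "nat \<Rightarrow> int list set \<Rightarrow> int list list set" where
  "EG n \<omega> = {T. young_shape T \<and>
       (\<forall>r\<in>set T. set r \<subseteq> {1 .. int n}) \<and>
       (\<forall>r\<in>set T. sorted_wrt (<) r) \<and>
       (\<forall>i j. Suc i < length T \<and> j < length (T ! Suc i) \<longrightarrow> T ! i ! j < T ! Suc i ! j) \<and>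
       concat (rev T) \<in> reduced_words \<omega>}"

text \<open>Alphabet 1' < 1 < ... < k' < k encoded as 1 < 2 < ... < 2k - 1 < 2k:
  i' is 2i - 1 and i is 2i.\<close>
definition primed_tableaux :: "nat \<Rightarrow> nat list \<Rightarrow> nat list list set" where
  "primed_tableaux k lam = {T. map length T = lam \<and>
       (\<forall>r\<in>set T. set r \<subseteq> {1 .. 2 * k}) \<and>
       (\<forall>r\<in>set T. sorted r) \<and>
       (\<forall>i j. Suc i < length T \<and> j < length (T ! Suc i) \<longrightarrow> T ! i ! j \<le> T ! Suc i ! j) \<and>
       (\<forall>i j j'. i < length T \<and> j < length (T ! i) \<and> j' < length (T ! i) \<and> j \<noteq> j' \<and>
                 T ! i ! j = T ! i ! j' \<longrightarrow> even (T ! i ! j)) \<and>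
       (\<forall>i i' j. i < length T \<and> i' < length T \<and> j < length (T ! i) \<and> j < length (T ! i') \<and>
                 i \<noteq> i' \<and> T ! i ! j = T ! i' ! j \<longrightarrow> odd (T ! i ! j))}"

definition wtX :: "nat list list \<Rightarrow> nat \<Rightarrow> nat" where
  "wtX T i = (if 1 \<le> i then length (filter (\<lambda>e. e = 2 * i - 1) (concat T)) else 0)"

definition wtY :: "nat list list \<Rightarrow> nat \<Rightarrow> nat" where
  "wtY T i = (if 1 \<le> i then length (filter (\<lambda>e. e = 2 * i) (concat T)) else 0)"

text \<open>R_\<lambda>(x_1..x_k, y_1..y_k) as coefficient function.\<close>
definition R :: "nat \<Rightarrow> nat list \<Rightarrow> (nat \<Rightarrow> nat) \<times> (nat \<Rightarrow> nat) \<Rightarrow> nat" where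
  "R k lam = (\<lambda>(X, Y). card {T \<in> primed_tableaux k lam. wtX T = X \<and> wtY T = Y})"

end

theory Submission
  imports Defs "HOL-Library.Multiset"
begin

text \<open>Letters of a reduced word of an element of A_n are nonzero and can be replaced by their
  absolute values, so an increasing block becomes a strictly decreasing run (the negative letters)
  followed by a strictly increasing run (the positive letters) of a reduced word in s_1, ..., s_n.
  Edelman--Greene insertion maps such a word bijectively to a pair (T, q), where T is an
  Edelman--Greene tableau and q is the lattice word recording the row of each new cell; it turns
  ascents of the word into weak descents of q and descents into ascents.  A decreasing run of the
  word thus adds a vertical strip and an increasing run adds a horizontal strip, and a chain of
  shapes growing alternately by vertical and horizontal strips is a primed tableau.
  Only relations of W are used, never the faithfulness of a model of it: all words involved are of
  minimal length in their class.\<close>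

section \<open>Reduced words\<close>

text \<open>The obstacle is that insertion is only partial: there is no rule for a letter x meeting
  a row that contains x but not x + 1. Minimal length excludes this case, since x could then be
  commuted next to its equal and cancelled. Insertion is therefore an inductive relation, whose
  existence in both directions is proved apart from its determinism, and minimality has to be
  carried through every bump by equivalences between words of equal length. Minimality also makes
  neighbouring letters of a word distinct. The one-way statements on ascents and descents thus
  become equivalences, and runs can be transported back from q to w. No explicit bijection between
  recording words and primed tableaux is built. Cutting off the last segment of the former and the
  largest letter of the latter leaves the same sum over smaller shapes, so the numbers agree by
  induction. The equality is reached for every number k of blocks and for every single monomial; the
  identity of power series is the limit of these.\<close>

lemma wstep_letters:
  assumes "wstep n x y"
  shows "set x \<subseteq> letters n" "set y \<subseteq> letters n"
proof -
  obtain u v a b where h: "set u \<subseteq> letters n" "set v \<subseteq> letters n" "a \<in> letters n" "b \<in> letters n"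
      "x = u @ concat (replicate (mexp a b) [a, b]) @ v" "y = u @ v"
    using assms unfolding wstep_def by blast
  then show "set x \<subseteq> letters n" "set y \<subseteq> letters n"
    by (auto simp: set_replicate_conv_if split: if_splits)
qed

lemma wequiv_letters:
  assumes "wequiv n x y"
  shows "set x \<subseteq> letters n" "set y \<subseteq> letters n"
proof -
  show x: "set x \<subseteq> letters n" using assms by (simp add: wequiv_def)
  have "(symclp (wstep n))\<^sup>*\<^sup>* x y" using assms by (simp add: wequiv_def)
  then show "set y \<subseteq> letters n"
    using x by (induction) (auto simp: symclp_def dest: wstep_letters)
qed

lemma wequiv_refl: "set x \<subseteq> letters n \<Longrightarrow> wequiv n x x"
  by (simp add: wequiv_def)

lemma wequiv_sym:
  assumes "wequiv n x y"
  shows "wequiv n y x"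
  using assms wequiv_letters[OF assms] unfolding wequiv_def
  by (metis rtranclp_symclp_sym)

lemma wequiv_trans [trans]: "wequiv n x y \<Longrightarrow> wequiv n y z \<Longrightarrow> wequiv n x z"
  unfolding wequiv_def by auto

lemma wstep_context:
  assumes "wstep n x y" "set p \<subseteq> letters n" "set s \<subseteq> letters n"
  shows "wstep n (p @ x @ s) (p @ y @ s)"
proof -
  obtain u v a b where h: "set u \<subseteq> letters n" "set v \<subseteq> letters n" "a \<in> letters n" "b \<in> letters n"
      "x = u @ concat (replicate (mexp a b) [a, b]) @ v" "y = u @ v"
    using assms unfolding wstep_def by blast
  show ?thesis unfolding wstep_def
    by (rule exI[of _ "p @ u"], rule exI[of _ "v @ s"], rule exI[of _ a], rule exI[of _ b])
      (use h assms in auto)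
qed

lemma wequiv_context:
  assumes "wequiv n x y" "set p \<subseteq> letters n" "set s \<subseteq> letters n"
  shows "wequiv n (p @ x @ s) (p @ y @ s)"
proof -
  have "(symclp (wstep n))\<^sup>*\<^sup>* x y" using assms by (simp add: wequiv_def)
  then have "(symclp (wstep n))\<^sup>*\<^sup>* (p @ x @ s) (p @ y @ s)"
  proof induction
    case (step y z)
    then have "symclp (wstep n) (p @ y @ s) (p @ z @ s)"
      using assms(2,3) by (auto simp: symclp_def intro: wstep_context)
    with step.IH show ?case by (rule rtranclp.rtrancl_into_rtrancl)
  qed simp
  then show ?thesis using assms by (simp add: wequiv_def)
qed

lemma wequiv_append:
  assumes "wequiv n x y" "wequiv n x' y'"
  shows "wequiv n (x @ x') (y @ y')"
proof -
  have "wequiv n ([] @ x @ x') ([] @ y @ x')"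
    using assms wequiv_letters by (intro wequiv_context) auto
  moreover have "wequiv n (y @ x' @ []) (y @ y' @ [])"
    using assms wequiv_letters by (intro wequiv_context) auto
  ultimately show ?thesis by (auto intro: wequiv_trans)
qed

lemma wequiv_relator:
  assumes "a \<in> letters n" "b \<in> letters n"
  shows "wequiv n (concat (replicate (mexp a b) [a, b])) []"
proof -
  have "wstep n (concat (replicate (mexp a b) [a, b])) []"
    unfolding wstep_def
    by (rule exI[of _ "[]"], rule exI[of _ "[]"], rule exI[of _ a], rule exI[of _ b])
      (use assms in auto)
  then show ?thesis
    using wstep_letters(1) unfolding wequiv_def by (blast intro: r_into_rtranclp symclpI)
qed

lemma wequiv_square: "a \<in> letters n \<Longrightarrow> wequiv n [a, a] []"
  using wequiv_relator[of a n a] by (simp add: mexp_def)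

lemma wequiv_cancel:
  assumes "a \<in> letters n" "set p \<subseteq> letters n" "set s \<subseteq> letters n"
  shows "wequiv n (p @ a # a # s) (p @ s)"
  using wequiv_context[OF wequiv_square[OF assms(1)] assms(2,3)] by simp

text \<open>Equal absolute values give \<open>mexp a (- a) = 1\<close>, so \<open>[a, - a]\<close>
  is itself a relator; as both generators are involutions, they coincide in W.\<close>

lemma wequiv_neg:
  assumes "a \<in> letters n"
  shows "wequiv n [a] [- a]"
proof -
  have l: "- a \<in> letters n" using assms by (auto simp: letters_def)
  have "wequiv n [a] ([a] @ [- a, - a] @ [])"
    using wequiv_sym[OF wequiv_context[OF wequiv_square[OF l], of "[a]" "[]"]] assms by simp
  also have "wequiv n ([a] @ [- a, - a] @ []) [- a]"
    using wequiv_context[OF wequiv_relator[OF assms l], of "[]" "[- a]"] l by (simp add: mexp_def)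
  finally show ?thesis .
qed

lemma wequiv_map_abs: "set v \<subseteq> letters n \<Longrightarrow> wequiv n v (map abs v)"
proof (induction v)
  case (Cons a v)
  have "wequiv n [a] [\<bar>a\<bar>]"
    using Cons.prems wequiv_neg[of a n] wequiv_refl[of "[a]" n] by (auto simp: abs_if)
  from wequiv_append[OF this Cons.IH] Cons.prems show ?case by auto
qed (simp add: wequiv_refl)

lemma letters_pos: "{1..int n} \<subseteq> letters n"
  by (auto simp: letters_def)

lemma pos_letters: "1 \<le> a \<Longrightarrow> a \<le> int n \<Longrightarrow> a \<in> letters n"
  by (auto simp: letters_def)

text \<open>Squares are inserted until the word starts with \<open>a, b, a, b\<close>, the relator
  for \<open>mexp a b = 2\<close>; deleting it leaves the letters in the opposite order and one more
  square.\<close>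

lemma wequiv_commute:
  assumes "a \<in> {1..int n}" "b \<in> {1..int n}" "\<bar>a - b\<bar> \<ge> 2"
  shows "wequiv n [a, b] [b, a]"
proof -
  have l: "a \<in> letters n" "b \<in> letters n" using assms pos_letters by auto
  have "mexp a b = 2" using assms by (auto simp: mexp_def)
  then have r: "wequiv n [a, b, a, b] []"
    using wequiv_relator[OF l] by (simp add: numeral_2_eq_2)
  have "wequiv n [a, b] [a, b, b, b]"
    using wequiv_sym[OF wequiv_cancel[OF l(2), of "[a]" "[b]"]] l by simp
  also have "wequiv n [a, b, b, b] [a, b, a, a, b, b]"
    using wequiv_sym[OF wequiv_cancel[OF l(1), of "[a, b]" "[b, b]"]] l by simp
  also have "wequiv n [a, b, a, a, b, b] [a, b, a, b, b, a, b, b]"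
    using wequiv_sym[OF wequiv_cancel[OF l(2), of "[a, b, a]" "[a, b, b]"]] l by simp
  also have "wequiv n [a, b, a, b, b, a, b, b] [b, a, b, b]"
    using wequiv_context[OF r, of "[]" "[b, a, b, b]"] l by simp
  also have "wequiv n [b, a, b, b] [b, a]"
    using wequiv_cancel[OF l(2), of "[b, a]" "[]"] l by simp
  finally show ?thesis .
qed

text \<open>The same device as for commutation, now with a relator of length six:
  \<open>mexp a (a + 1) = 3\<close> because neither index is 0.\<close>

lemma wequiv_braid:
  assumes "a \<in> {1..int n}" "a + 1 \<in> {1..int n}"
  shows "wequiv n [a, a + 1, a] [a + 1, a, a + 1]"
proof -
  define b where "b = a + 1"
  have l: "a \<in> letters n" "b \<in> letters n" using assms pos_letters by (auto simp: b_def)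
  have "mexp a b = 3" using assms by (auto simp: mexp_def b_def)
  then have r: "wequiv n [a, b, a, b, a, b] []"
    using wequiv_relator[OF l] by (simp add: numeral_3_eq_3)
  have "wequiv n [a, b, a] [a, b, a, b, b]"
    using wequiv_sym[OF wequiv_cancel[OF l(2), of "[a, b, a]" "[]"]] l by simp
  also have "wequiv n [a, b, a, b, b] [a, b, a, b, a, a, b]"
    using wequiv_sym[OF wequiv_cancel[OF l(1), of "[a, b, a, b]" "[b]"]] l by simp
  also have "wequiv n [a, b, a, b, a, a, b] [a, b, a, b, a, b, b, a, b]"
    using wequiv_sym[OF wequiv_cancel[OF l(2), of "[a, b, a, b, a]" "[a, b]"]] l by simp
  also have "wequiv n [a, b, a, b, a, b, b, a, b] [b, a, b]"
    using wequiv_context[OF r, of "[]" "[b, a, b]"] l by simp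
  finally show ?thesis by (simp add: b_def)
qed

text \<open>The relation m_ab = 4 involving s_0 is even, so killing s_0 is a retraction of W onto A_n.\<close>

lemma wstep_remove_zeros:
  assumes "wstep n x y"
  shows "wequiv n (filter (\<lambda>a. a \<noteq> 0) x) (filter (\<lambda>a. a \<noteq> 0) y)"
proof -
  obtain u v a b where h: "set u \<subseteq> letters n" "set v \<subseteq> letters n" "a \<in> letters n" "b \<in> letters n"
      "x = u @ concat (replicate (mexp a b) [a, b]) @ v" "y = u @ v"
    using assms unfolding wstep_def by blast
  have fc: "filter (\<lambda>a. a \<noteq> 0) (concat (replicate k [a, b]))
      = concat (replicate k (filter (\<lambda>a. a \<noteq> 0) [a, b]))" for k
    by (induction k) auto
  \<comment> \<open>Needed when exactly one of \<open>a\<close>, \<open>b\<close> is 0: deleting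
    zeros then turns the relator into a power of the other letter, with exponent 2 or 4.\<close>
  have even_power: "wequiv n (concat (replicate (mexp a b) [c])) []"
    if "even (mexp a b)" "c \<in> letters n" for c
  proof -
    have two: "mexp a b = 2 \<or> mexp a b = 4"
      using that by (auto simp: mexp_def split: if_splits)
    have "wequiv n [c, c, c, c] [c, c]"
      using wequiv_cancel[OF that(2), of "[]" "[c, c]"] that by simp
    then have "wequiv n [c, c, c, c] []" using wequiv_square[OF that(2)] wequiv_trans by blast
    moreover have "concat (replicate 2 [c]) = [c, c]" "concat (replicate 4 [c]) = [c, c, c, c]"
      by (simp_all add: numeral_eq_Suc)
    ultimately show ?thesis using two wequiv_square[OF that(2)] by auto
  qed
  have "wequiv n (filter (\<lambda>a. a \<noteq> 0) (concat (replicate (mexp a b) [a, b]))) []"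
  proof (cases "a = 0 \<or> b = 0")
    case False
    then show ?thesis using wequiv_relator[OF h(3,4)] by (simp add: fc)
  next
    case True
    show ?thesis
    proof (cases "a = 0 \<and> b = 0")
      case True
      then show ?thesis by (simp add: fc wequiv_refl)
    next
      case False
      then have "even (mexp a b)" using True by (auto simp: mexp_def)
      then show ?thesis using even_power h(3,4) True False by (auto simp: fc)
    qed
  qed
  from wequiv_context[OF this, of "filter (\<lambda>a. a \<noteq> 0) u" "filter (\<lambda>a. a \<noteq> 0) v"] h
  show ?thesis by auto
qed

lemma wequiv_remove_zeros:
  assumes "wequiv n x y"
  shows "wequiv n (filter (\<lambda>a. a \<noteq> 0) x) (filter (\<lambda>a. a \<noteq> 0) y)"
proof -
  have "(symclp (wstep n))\<^sup>*\<^sup>* x y" using assms by (simp add: wequiv_def)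
  then show ?thesis
  proof induction
    case base
    have "set x \<subseteq> letters n" using assms by (rule wequiv_letters)
    then show ?case by (intro wequiv_refl) auto
  next
    case (step y z)
    have "wequiv n (filter (\<lambda>a. a \<noteq> 0) y) (filter (\<lambda>a. a \<noteq> 0) z)"
      using step.hyps(2) unfolding symclp_def
      by (auto intro: wstep_remove_zeros wequiv_sym)
    with step.IH show ?case by (rule wequiv_trans)
  qed
qed

section \<open>Words of minimal length and their factors\<close>

text \<open>Minimality is meant in W, against all words over \<open>letters n\<close>, so it
  transfers along every relation of W that preserves length.\<close>

definition red :: "nat \<Rightarrow> int list \<Rightarrow> bool" where
  "red n w \<longleftrightarrow> set w \<subseteq> letters n \<and> (\<forall>u. wequiv n w u \<longrightarrow> length w \<le> length u)"

lemma mem_reduced_words: "v \<in> reduced_words (W_elem n w) \<longleftrightarrow> wequiv n w v \<and> red n v"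
  unfolding reduced_words_def W_elem_def red_def
  using wequiv_letters(2)[of n w v] wequiv_trans[of n w v] wequiv_trans[OF wequiv_sym, of n w v]
  by blast

lemma red_wequiv: "red n v \<Longrightarrow> wequiv n v w \<Longrightarrow> length w = length v \<Longrightarrow> red n w"
  unfolding red_def by (metis wequiv_letters(2) wequiv_trans)

text \<open>A shorter word for the factor could be put in its place.\<close>

lemma red_middle:
  assumes "red n (p @ x @ s)"
  shows "red n x"
proof -
  have "length x \<le> length u" if "wequiv n x u" for u
  proof -
    have "wequiv n (p @ x @ s) (p @ u @ s)"
      using that assms unfolding red_def by (intro wequiv_context) auto
    then have "length (p @ x @ s) \<le> length (p @ u @ s)" using assms unfolding red_def by blast
    then show ?thesis by simp
  qed
  then show ?thesis using assms by (auto simp: red_def)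
qed

lemma red_prefix: "red n (x @ s) \<Longrightarrow> red n x"
  using red_middle[of n "[]" x s] by simp

lemma red_suffix: "red n (p @ x) \<Longrightarrow> red n x"
  using red_middle[of n p x "[]"] by simp

lemma red_no_square: "\<not> red n (p @ a # a # s)"
proof
  assume r: "red n (p @ a # a # s)"
  then have "wequiv n (p @ a # a # s) (p @ s)"
    by (intro wequiv_cancel) (auto simp: red_def)
  then show False using r by (auto simp: red_def)
qed

text \<open>As \<open>w\<close> has no zeros, deleting the zeros from any word for its element gives
  another word for it, so a reduced word has none to delete. Passing to absolute values changes
  neither the element nor the length.\<close>

lemma mem_reduced_words_iff_abs:
  assumes "set w \<subseteq> {1..int n}"
  shows "v \<in> reduced_words (W_elem n w) \<longleftrightarrow>
    set v \<subseteq> letters n \<and> 0 \<notin> set v \<and> map abs v \<in> reduced_words (W_elem n w)"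
proof -
  have *: "v \<in> reduced_words (W_elem n w) \<longleftrightarrow> map abs v \<in> reduced_words (W_elem n w)"
    if "set v \<subseteq> letters n"
    unfolding mem_reduced_words
    using wequiv_map_abs[OF that] red_wequiv[of n v "map abs v"] red_wequiv[of n "map abs v" v]
    by (auto intro: wequiv_trans wequiv_sym)
  have "0 \<notin> set v" if "v \<in> reduced_words (W_elem n w)"
  proof
    assume z: "0 \<in> set v"
    have r: "wequiv n w v" "red n v" using that by (simp_all add: mem_reduced_words)
    have "filter (\<lambda>a. a \<noteq> 0) w = w" using assms by (auto simp: filter_id_conv)
    then have "wequiv n w (filter (\<lambda>a. a \<noteq> 0) v)" using wequiv_remove_zeros[OF r(1)] by simp
    then have "wequiv n v (filter (\<lambda>a. a \<noteq> 0) v)" using r(1) wequiv_sym wequiv_trans by blast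
    then have "length v \<le> length (filter (\<lambda>a. a \<noteq> 0) v)" using r(2) by (simp add: red_def)
    moreover have "length (filter (\<lambda>a. a \<noteq> 0) v) < length v"
      using z by (intro length_filter_less) auto
    ultimately show False by simp
  qed
  moreover have "set v \<subseteq> letters n" if "v \<in> reduced_words (W_elem n w)"
    using that by (simp add: mem_reduced_words red_def)
  ultimately show ?thesis using * by blast
qed

section \<open>Edelman--Greene insertion\<close>

text \<open>\<open>bump r x y r'\<close>: inserting \<open>x\<close> into the row \<open>r\<close>
  expels \<open>y\<close> and leaves \<open>r'\<close>. The rule \<open>special\<close> is the
  Edelman--Greene modification of row insertion and mirrors the braid relation. Neither rule applies
  if \<open>x\<close> exceeds the whole row or if \<open>x\<close> occurs without
  \<open>x + 1\<close>. It is a relation because it is also read backwards.\<close>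

inductive bump :: "int list \<Rightarrow> int \<Rightarrow> int \<Rightarrow> int list \<Rightarrow> bool" where
  normal: "x < y \<Longrightarrow> \<forall>e\<in>set a. e < x \<Longrightarrow> \<forall>e\<in>set z. y < e \<Longrightarrow> bump (a @ y # z) x y (a @ x # z)"
| special: "\<forall>e\<in>set a. e < x \<Longrightarrow> \<forall>e\<in>set z. x + 1 < e \<Longrightarrow>
    bump (a @ x # (x + 1) # z) x (x + 1) (a @ x # (x + 1) # z)"

lemma bump_set: "bump r x y r' \<Longrightarrow> insert y (set r') = insert x (set r)"
  by (induction rule: bump.induct) auto

lemma bump_length: "bump r x y r' \<Longrightarrow> length r' = length r"
  by (induction rule: bump.induct) auto

lemma bump_less: "bump r x y r' \<Longrightarrow> x < y"
  by (induction rule: bump.induct) auto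

lemma bump_mem: "bump r x y r' \<Longrightarrow> y \<in> set r \<and> x \<in> set r'"
  by (induction rule: bump.induct) auto

lemma bump_not_Nil: "bump r x y r' \<Longrightarrow> r \<noteq> [] \<and> r' \<noteq> []"
  by (induction rule: bump.induct) auto

lemma bump_sorted: "bump r x y r' \<Longrightarrow> sorted_wrt (<) r' \<longleftrightarrow> sorted_wrt (<) r"
  by (induction rule: bump.induct) (fastforce simp: sorted_wrt_append)+

text \<open>Both sides are cut at the first entry violating \<open>P\<close>.\<close>

lemma split_unique:
  assumes "a @ y # z = a' @ y' # z'"
    and "\<forall>e\<in>set a. P e" "\<not> P y" "\<forall>e\<in>set a'. P e" "\<not> P y'"
  shows "a = a' \<and> y = y' \<and> z = z'"
  using assms
proof (induction a arbitrary: a')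
  case Nil
  then show ?case by (cases a') auto
next
  case (Cons b a)
  then show ?case by (cases a') auto
qed

lemma split_unique_right:
  assumes "a @ y # z = a' @ y' # z'"
    and "\<forall>e\<in>set z. P e" "\<not> P y" "\<forall>e\<in>set z'. P e" "\<not> P y'"
  shows "a = a' \<and> y = y' \<and> z = z'"
proof -
  have "rev z @ y # rev a = rev z' @ y' # rev a'"
    using arg_cong[OF assms(1), of rev] by simp
  then have "rev z = rev z' \<and> y = y' \<and> rev a = rev a'"
    by (rule split_unique[where P = P]) (use assms in auto)
  then show ?thesis by simp
qed

text \<open>The cut is at the first entry that is not below \<open>x\<close>; it is \<open>x\<close>
  itself exactly under \<open>special\<close>.\<close>

lemma bump_det_forward:
  assumes "bump r x y r'" "bump r x y2 r2"
  shows "y = y2 \<and> r' = r2"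
  using assms
proof (cases rule: bump.cases)
  case (normal a z)
  from assms(2) show ?thesis
  proof (cases rule: bump.cases)
    case n2: (normal a2 z2)
    have "a = a2 \<and> y = y2 \<and> z = z2"
      by (rule split_unique[where P = "\<lambda>e. e < x"]) (use normal n2 in auto)
    then show ?thesis using normal n2 by simp
  next
    case n2: (special a2 z2)
    have "a = a2 \<and> y = x \<and> z = (x + 1) # z2"
      by (rule split_unique[where P = "\<lambda>e. e < x"]) (use normal n2 in auto)
    then show ?thesis using normal by simp
  qed
next
  case (special a z)
  from assms(2) show ?thesis
  proof (cases rule: bump.cases)
    case n2: (normal a2 z2)
    have "a = a2 \<and> x = y2 \<and> (x + 1) # z = z2"
      by (rule split_unique[where P = "\<lambda>e. e < x"]) (use special n2 in auto)
    then show ?thesis using n2 by simp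
  next
    case n2: (special a2 z2)
    then show ?thesis using special by simp
  qed
qed

text \<open>The cut is at the last entry of \<open>r'\<close> that does not exceed \<open>y\<close>.
  It is smaller than \<open>y\<close> after \<open>normal\<close> and equal to \<open>y\<close>
  after \<open>special\<close>, so the rule and the inserted letter can be read off.\<close>

lemma bump_det_backward:
  assumes "bump r x y r'" "bump r2 x2 y r'"
  shows "x = x2 \<and> r = r2"
  using assms
proof (cases rule: bump.cases)
  case (normal a z)
  from assms(2) show ?thesis
  proof (cases rule: bump.cases)
    case n2: (normal a2 z2)
    have "a = a2 \<and> x = x2 \<and> z = z2"
      by (rule split_unique_right[where P = "\<lambda>e. y < e"]) (use normal n2 in auto)
    then show ?thesis using normal n2 by simp
  next
    case n2: (special a2 z2)
    have "a = a2 @ [x2] \<and> x = x2 + 1 \<and> z = z2"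
      by (rule split_unique_right[where P = "\<lambda>e. y < e"]) (use normal n2 in auto)
    then show ?thesis using normal n2 by simp
  qed
next
  case (special a z)
  from assms(2) show ?thesis
  proof (cases rule: bump.cases)
    case n2: (normal a2 z2)
    have "a @ [x] = a2 \<and> x + 1 = x2 \<and> z = z2"
      by (rule split_unique_right[where P = "\<lambda>e. y < e"]) (use special n2 in auto)
    then show ?thesis using n2 special by simp
  next
    case n2: (special a2 z2)
    then show ?thesis using special by simp
  qed
qed

section \<open>Bumping and the relations of the group\<close>

lemma move_left:
  assumes "set a \<subseteq> {1..int n}" "y \<in> {1..int n}" "\<forall>e\<in>set a. \<bar>e - y\<bar> \<ge> 2"
  shows "wequiv n (a @ [y]) (y # a)"
  using assms
proof (induction a)
  case Nil
  then show ?case using pos_letters[of y n] by (simp add: wequiv_refl)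
next
  case (Cons b a)
  have "wequiv n (b # a @ [y]) (b # y # a)"
    using wequiv_append[OF wequiv_refl[of "[b]"] Cons.IH] Cons.prems pos_letters[of b n] by auto
  also have "wequiv n (b # y # a) (y # b # a)"
    using wequiv_append[OF wequiv_commute[of b n y] wequiv_refl[of a]] Cons.prems letters_pos by force
  finally show ?case by simp
qed

lemma move_right:
  assumes "set a \<subseteq> {1..int n}" "y \<in> {1..int n}" "\<forall>e\<in>set a. \<bar>e - y\<bar> \<ge> 2"
  shows "wequiv n (y # a) (a @ [y])"
  using move_left[OF assms] by (rule wequiv_sym)

text \<open>Entries of \<open>z\<close> exceed a number above \<open>x\<close>, and entries of
  \<open>a\<close> lie below a number under \<open>y\<close>, so all of them differ by at least 2
  from the letter that has to pass: \<open>x\<close> moves left across \<open>z\<close>, and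
  \<open>y\<close> moves left across \<open>a\<close>. Under \<open>special\<close> one braid move
  in the middle creates the second \<open>x + 1\<close>.\<close>

lemma bump_wequiv:
  assumes "bump r x y r'" "set r \<subseteq> {1..int n}" "x \<in> {1..int n}"
  shows "wequiv n (r @ [x]) (y # r')"
  using assms
proof (cases rule: bump.cases)
  case (normal a z)
  have p: "set a \<subseteq> {1..int n}" "set z \<subseteq> {1..int n}" "y \<in> {1..int n}"
    using assms normal by auto
  then have l: "set a \<subseteq> letters n" "set z \<subseteq> letters n" "y \<in> letters n" "x \<in> letters n"
    using subsetD[OF letters_pos] assms(3) by auto
  have "wequiv n ((a @ [y]) @ (z @ [x]) @ []) ((a @ [y]) @ (x # z) @ [])"
    using move_left[of z n x] normal p assms(3) l by (intro wequiv_context) force+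
  also have "wequiv n ([] @ (a @ [y]) @ (x # z)) ([] @ (y # a) @ (x # z))"
    using move_left[of a n y] normal p l by (intro wequiv_context) force+
  then have "wequiv n ((a @ [y]) @ (x # z) @ []) (y # a @ x # z)" by simp
  finally show ?thesis using normal by simp
next
  case (special a z)
  have p: "set a \<subseteq> {1..int n}" "set z \<subseteq> {1..int n}" "x + 1 \<in> {1..int n}"
    using assms special by auto
  then have l: "set a \<subseteq> letters n" "set z \<subseteq> letters n" "x + 1 \<in> letters n" "x \<in> letters n"
    using subsetD[OF letters_pos] assms(3) by auto
  have "wequiv n ((a @ [x, x + 1]) @ (z @ [x]) @ []) ((a @ [x, x + 1]) @ (x # z) @ [])"
    using move_left[of z n x] special p assms(3) l by (intro wequiv_context) force+
  also have "wequiv n (a @ [x, x + 1, x] @ z) (a @ [x + 1, x, x + 1] @ z)"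
    using wequiv_braid[of x n] assms(3) p l by (intro wequiv_context) auto
  then have "wequiv n ((a @ [x, x + 1]) @ (x # z) @ []) (a @ [x + 1, x, x + 1] @ z)" by simp
  also have "wequiv n ([] @ (a @ [x + 1]) @ (x # (x + 1) # z)) ([] @ ((x + 1) # a) @ (x # (x + 1) # z))"
    using move_left[of a n "x + 1"] special p l by (intro wequiv_context) force+
  then have "wequiv n (a @ [x + 1, x, x + 1] @ z) ((x + 1) # a @ x # (x + 1) # z)" by simp
  finally show ?thesis using special by simp
qed

lemma sorted_split_at:
  fixes r :: "int list"
  assumes "sorted_wrt (<) r"
  shows "\<exists>a z. r = a @ z \<and> (\<forall>e\<in>set a. e < x) \<and> (\<forall>e\<in>set z. x \<le> e)"
proof (intro exI conjI)
  show "r = takeWhile (\<lambda>e. e < x) r @ dropWhile (\<lambda>e. e < x) r" by simp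
  show "\<forall>e\<in>set (takeWhile (\<lambda>e. e < x) r). e < x" by (auto dest: set_takeWhileD)
  show "\<forall>e\<in>set (dropWhile (\<lambda>e. e < x) r). x \<le> e"
    using assms
  proof (induction r)
    case (Cons b r)
    then show ?case by (cases "b < x") fastforce+
  qed simp
qed

text \<open>If \<open>x + 1\<close> did not follow, all of \<open>z\<close> would commute with
  \<open>x\<close>, and the last \<open>x\<close> could be moved next to the first, giving a
  square.\<close>

lemma red_repeat_sorted:
  assumes "sorted_wrt (<) z" "red n (x # z @ [x])" "set (x # z) \<subseteq> {1..int n}" "\<forall>e\<in>set z. x < e"
  shows "\<exists>z'. z = (x + 1) # z'"
proof (rule ccontr)
  assume no: "\<nexists>z'. z = (x + 1) # z'"
  have "\<forall>e\<in>set z. x + 1 < e"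
    using assms(1,4) no by (cases z) force+
  then have "wequiv n ([x] @ (z @ [x]) @ []) ([x] @ (x # z) @ [])"
    using assms(3) letters_pos by (intro wequiv_context move_left) force+
  then have "red n ([] @ x # x # z)" by (auto intro: red_wequiv[OF assms(2)])
  then show False using red_no_square by blast
qed

lemma red_repeat_sorted_left:
  assumes "sorted_wrt (<) a" "red n (y # a @ [y])" "set (y # a) \<subseteq> {1..int n}" "\<forall>e\<in>set a. e < y"
  shows "\<exists>a'. a = a' @ [y - 1]"
proof (rule ccontr)
  assume no: "\<nexists>a'. a = a' @ [y - 1]"
  have "\<forall>e\<in>set a. e < y - 1"
    using assms(1,4) no by (cases a rule: rev_cases) (force simp: sorted_wrt_append)+
  then have "wequiv n ([] @ (y # a) @ [y]) ([] @ (a @ [y]) @ [y])"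
    using assms(3) letters_pos by (intro wequiv_context move_right) force+
  then have "red n (a @ y # y # [])" by (auto intro: red_wequiv[OF assms(2)])
  then show False using red_no_square by blast
qed

text \<open>The critical case is a row containing \<open>x\<close>: reducedness then puts
  \<open>x + 1\<close> next to it, as \<open>special\<close> requires.\<close>

lemma bump_exists_forward:
  assumes "sorted_wrt (<) r" "red n (r @ [x])" "set r \<subseteq> {1..int n}" "x \<in> {1..int n}"
    and "\<not> (\<forall>e\<in>set r. e < x)"
  shows "\<exists>y r'. bump r x y r'"
proof -
  obtain a z where r: "r = a @ z" "\<forall>e\<in>set a. e < x" "\<forall>e\<in>set z. x \<le> e"
    using sorted_split_at[OF assms(1)] by blast
  then obtain y z' where z: "z = y # z'" using assms(5) by (cases z) auto
  have s: "sorted_wrt (<) z'" "\<forall>e\<in>set z'. y < e"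
    using assms(1) r(1) z by (auto simp: sorted_wrt_append)
  show ?thesis
  proof (cases "y = x")
    case False
    then show ?thesis using r z s bump.normal[of x y a z'] by auto
  next
    case True
    have "red n (x # z' @ [x])"
      using assms(2) red_suffix[of n a "x # z' @ [x]"] r z True by simp
    then obtain z'' where "z' = (x + 1) # z''"
      using red_repeat_sorted[of z' n x] s True assms(3,4) r z by auto
    then show ?thesis using r z s bump.special[of a x z''] True by auto
  qed
qed

text \<open>The place is the last entry below \<open>y\<close>. If \<open>y\<close> itself occurs in
  \<open>r'\<close>, reducedness forces that entry to be \<open>y - 1\<close>, as
  \<open>special\<close> requires.\<close>

lemma bump_exists_backward:
  assumes "sorted_wrt (<) r'" "red n (y # r')" "set r' \<subseteq> {1..int n}" "y \<in> {1..int n}"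
    and "\<exists>e\<in>set r'. e < y"
  shows "\<exists>x r. bump r x y r'"
proof -
  obtain a z where r: "r' = a @ z" "\<forall>e\<in>set a. e < y" "\<forall>e\<in>set z. y \<le> e"
    using sorted_split_at[OF assms(1)] by blast
  then obtain x a' where a: "a = a' @ [x]" using assms(5) by (cases a rule: rev_cases) auto
  have s: "sorted_wrt (<) a" "\<forall>e\<in>set a'. e < x" "sorted_wrt (<) z"
    using assms(1) r(1) a by (auto simp: sorted_wrt_append)
  show ?thesis
  proof (cases "y \<in> set z")
    case False
    then have "\<forall>e\<in>set z. y < e" using r(3) by (metis order_le_less)
    then show ?thesis using r a s bump.normal[of x y a' z] by auto
  next
    case True
    then obtain z' where z: "z = y # z'"
      using s(3) r(3) by (cases z) force+
    have "red n (y # a @ [y])"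
      using assms(2) red_prefix[of n "y # a @ [y]" z'] r z by simp
    then have "x = y - 1"
      using red_repeat_sorted_left[of a n y] s r assms(3,4) a by auto
    then show ?thesis using r a s z bump.special[of a' x z'] by auto
  qed
qed

section \<open>Insertion into a tableau and the comparison of successive insertions\<close>

text \<open>\<open>i\<close> is the row, counted from 0 at the top, that gains a cell. The condition
  \<open>r \<noteq> []\<close> in \<open>app\<close> leaves \<open>Nil\<close> as the only origin of
  a one-cell tableau, which keeps the inverse deterministic.\<close>

inductive ins :: "int list list \<Rightarrow> int \<Rightarrow> nat \<Rightarrow> int list list \<Rightarrow> bool" where
  Nil: "ins [] x 0 [[x]]"
| app: "r \<noteq> [] \<Longrightarrow> \<forall>e\<in>set r. e < x \<Longrightarrow> ins (r # T) x 0 ((r @ [x]) # T)"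
| bump: "bump r x y r' \<Longrightarrow> ins T y i T' \<Longrightarrow> ins (r # T) x (Suc i) (r' # T')"

lemma bump_not_app: "bump r x y r' \<Longrightarrow> \<not> (\<forall>e\<in>set r. e < x)"
  using bump_mem bump_less by (meson less_asym)

lemma ins_det_forward: "ins T x i T' \<Longrightarrow> ins T x i2 T2 \<Longrightarrow> i = i2 \<and> T' = T2"
proof (induction arbitrary: i2 T2 rule: ins.induct)
  case (Nil x)
  then show ?case by (auto elim: ins.cases)
next
  case (app r x T)
  from app.prems show ?case
    by (cases rule: ins.cases) (use app bump_not_app in auto)
next
  case (bump r x y r' T i T')
  from bump.prems show ?case
    by (cases rule: ins.cases) (use bump bump_not_app bump_det_forward in blast)+
qed

lemma ins_det_backward: "ins T x i T' \<Longrightarrow> ins T2 x2 i T' \<Longrightarrow> x = x2 \<and> T = T2"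
proof (induction arbitrary: x2 T2 rule: ins.induct)
  case (Nil x)
  then show ?case by (auto elim: ins.cases)
next
  case (app r x T)
  from app.prems show ?case
    by (cases rule: ins.cases) (use app in auto)
next
  case (bump r x y r' T i T')
  from bump.prems show ?case
  proof (cases rule: ins.cases)
    case (bump r2 y2 S)
    then show ?thesis using bump.IH bump.hyps(1) bump_det_backward by blast
  qed
qed

text \<open>After \<open>normal\<close>, \<open>x\<close> occupies the place of \<open>y\<close>,
  and every larger entry lies to its right, hence exceeds \<open>y\<close>. After
  \<open>special\<close>, \<open>y = x + 1 \<le> x2 < y2\<close>.\<close>

lemma bump_mono_up:
  assumes "bump r x y r'" "bump r' x2 y2 r''" "x < x2"
  shows "y < y2"
  using assms
proof (cases rule: bump.cases)
  case (normal a z)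
  then have "y2 \<in> set z" using bump_mem[OF assms(2)] bump_less[OF assms(2)] assms(3) by auto
  then show ?thesis using normal by auto
next
  case (special a z)
  then show ?thesis using bump_less[OF assms(2)] assms(3) by linarith
qed

text \<open>\<open>x\<close> now belongs to the row and exceeds \<open>x2\<close>, so the expelled
  \<open>y2\<close> is at most \<open>x\<close>, which is less than \<open>y\<close>.\<close>

lemma bump_mono_down:
  assumes "bump r x y r'" "bump r' x2 y2 r''" "x2 < x"
  shows "y2 < y"
proof -
  have x: "x \<in> set r'" "x < y" using assms(1) bump_mem bump_less by auto
  from assms(2) show ?thesis
  proof (cases rule: bump.cases)
    case (normal a z)
    then have "x = y2 \<or> x \<in> set z" using x assms(3) by auto
    then show ?thesis using normal x by auto
  next
    case (special a z)
    then show ?thesis using x assms(3) by auto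
  qed
qed

text \<open>The order of the two travelling letters persists from row to row. In the row where the
  first letter was appended, the larger one exceeds everything and is appended too, unless it has
  come to rest earlier.\<close>

lemma ins_mono_up: "ins T x i T' \<Longrightarrow> ins T' x2 i2 T2 \<Longrightarrow> x < x2 \<Longrightarrow> i2 \<le> i"
proof (induction arbitrary: x2 i2 T2 rule: ins.induct)
  case (Nil x)
  from Nil.prems(1) show ?case
    by (cases rule: ins.cases) (use Nil bump_not_app[of "[x]" x2] in auto)
next
  case (app r x T)
  from app.prems(1) show ?case
    by (cases rule: ins.cases) (use app bump_not_app[of "r @ [x]" x2] in force)+
next
  case (bump r x y r' T i T')
  from bump.prems(1) show ?case
  proof (cases rule: ins.cases)
    case (bump y2 r2 i' S)
    then show ?thesis
      using bump.IH[of y2 i' S] bump_mono_up[OF bump.hyps(1)] bump.prems(2) by auto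
  qed auto
qed

text \<open>In the row where the first letter was appended, the smaller one meets a larger entry, so
  it cannot come to rest there or above.\<close>

lemma ins_mono_down: "ins T x i T' \<Longrightarrow> ins T' x2 i2 T2 \<Longrightarrow> x2 < x \<Longrightarrow> i < i2"
proof (induction arbitrary: x2 i2 T2 rule: ins.induct)
  case (Nil x)
  from Nil.prems(1) show ?case
    by (cases rule: ins.cases) (use Nil in auto)
next
  case (app r x T)
  from app.prems(1) show ?case
    by (cases rule: ins.cases) (use app in auto)
next
  case (bump r x y r' T i T')
  from bump.prems(1) show ?case
  proof (cases rule: ins.cases)
    case app
    then show ?thesis using bump_mem[OF bump.hyps(1)] bump.prems(2) by auto
  next
    case (bump y2 r2 i' S)
    then show ?thesis
      using bump.IH[of y2 i' S] bump_mono_down[OF bump.hyps(1)] bump.prems(2) by auto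
  qed
qed

section \<open>Lattice words and words made of runs\<close>

text \<open>The Yamanouchi condition. If letters are the rows of successively added cells, every
  prefix has a partition as its content, so \<open>q\<close> encodes a standard Young
  tableau.\<close>

definition lattice_word :: "nat list \<Rightarrow> bool" where
  "lattice_word q \<longleftrightarrow> (\<forall>p s. q = p @ s \<longrightarrow> (\<forall>i. count_list p (Suc i) \<le> count_list p i))"

lemma lattice_wordD: "lattice_word (p @ s) \<Longrightarrow> count_list p (Suc i) \<le> count_list p i"
  by (auto simp: lattice_word_def)

lemma lattice_word_prefix: "lattice_word (p @ s) \<Longrightarrow> lattice_word p"
  by (auto simp: lattice_word_def)

lemma lattice_word_snoc:
  "lattice_word (q @ [i]) \<longleftrightarrow>
    lattice_word q \<and> (\<forall>j. count_list (q @ [i]) (Suc j) \<le> count_list (q @ [i]) j)"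
proof
  assume "lattice_word (q @ [i])"
  then show "lattice_word q \<and> (\<forall>j. count_list (q @ [i]) (Suc j) \<le> count_list (q @ [i]) j)"
    using lattice_word_prefix lattice_wordD[of "q @ [i]" "[]"] by simp
next
  assume h: "lattice_word q \<and> (\<forall>j. count_list (q @ [i]) (Suc j) \<le> count_list (q @ [i]) j)"
  show "lattice_word (q @ [i])"
    unfolding lattice_word_def
  proof (intro allI impI)
    fix p s j assume e: "q @ [i] = p @ s"
    show "count_list p (Suc j) \<le> count_list p j"
    proof (cases s rule: rev_cases)
      case Nil
      then show ?thesis using h e by simp
    next
      case (snoc s' x)
      then show ?thesis using h e lattice_wordD[of p s'] by simp
    qed
  qed
qed


text \<open>The segment lengths c are listed from the last segment to the first; as letters are numbered
  from 1, the segments of the odd letters i' are those with an even number of predecessors.\<close>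

fun alt :: "('a \<Rightarrow> 'a \<Rightarrow> bool) \<Rightarrow> ('a \<Rightarrow> 'a \<Rightarrow> bool) \<Rightarrow> nat list \<Rightarrow> 'a list \<Rightarrow> bool" where
  "alt P Q [] w \<longleftrightarrow> w = []"
| "alt P Q (m # c) w \<longleftrightarrow> (\<exists>u v. w = u @ v \<and> length v = m \<and> alt P Q c u \<and>
     successively (if even (length c) then P else Q) v)"

text \<open>The cut points depend only on \<open>c\<close>, so comparing neighbouring letters
  position by position is enough.\<close>

lemma alt_transfer:
  assumes "alt P Q c w" "length w = length q"
    and "\<And>j. Suc j < length w \<Longrightarrow> P (w ! j) (w ! Suc j) \<Longrightarrow> P' (q ! j) (q ! Suc j)"
    and "\<And>j. Suc j < length w \<Longrightarrow> Q (w ! j) (w ! Suc j) \<Longrightarrow> Q' (q ! j) (q ! Suc j)"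
  shows "alt P' Q' c q"
  using assms
proof (induction c arbitrary: w q)
  case (Cons m c)
  then obtain u v where w: "w = u @ v" "length v = m" "alt P Q c u"
    "successively (if even (length c) then P else Q) v" by auto
  let ?k = "length u"
  have "alt P' Q' c (take ?k q)"
    by (rule Cons.IH[OF w(3)]) (use Cons.prems(2) Cons.prems(3,4) w(1) in \<open>auto simp: nth_append\<close>)
  moreover have "successively (if even (length c) then P' else Q') (drop ?k q)"
    unfolding successively_conv_nth
  proof (intro allI impI)
    fix j assume j: "Suc j < length (drop ?k q)"
    then have "(if even (length c) then P else Q) (w ! (?k + j)) (w ! Suc (?k + j))"
      using w Cons.prems(2) by (auto simp: successively_conv_nth nth_append)
    then show "(if even (length c) then P' else Q') (drop ?k q ! j) (drop ?k q ! Suc j)"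
      using Cons.prems(3,4)[of "?k + j"] j w(1) Cons.prems(2) by (auto split: if_splits)
  qed
  moreover have "length (drop ?k q) = m" using Cons.prems(2) w by simp
  ultimately show ?case by (metis alt.simps(2) append_take_drop_id)
qed simp

section \<open>Column strictness under insertion and its inverse\<close>

text \<open>The default \<open>[]\<close> makes the column condition against an empty rest of the
  tableau vacuous.\<close>

definition first :: "int list list \<Rightarrow> int list" where
  "first T = (case T of [] \<Rightarrow> [] | r # _ \<Rightarrow> r)"

lemma first_simps [simp]: "first [] = []" "first (r # T) = r"
  by (simp_all add: first_def)

definition below :: "int list \<Rightarrow> int list \<Rightarrow> bool" where
  "below r s \<longleftrightarrow> length s \<le> length r \<and> (\<forall>j<length s. r ! j < s ! j)"

text \<open>The conditions on an Edelman--Greene tableau apart from alphabet and reading word,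
  stated row by row to suit induction along \<open>ins\<close>; see \<open>tab_iff\<close>.\<close>

fun tab :: "int list list \<Rightarrow> bool" where
  "tab [] \<longleftrightarrow> True"
| "tab (r # T) \<longleftrightarrow> r \<noteq> [] \<and> sorted_wrt (<) r \<and> below r (first T) \<and> tab T"

fun rowlen :: "'a list list \<Rightarrow> nat \<Rightarrow> nat" where
  "rowlen [] i = 0"
| "rowlen (r # T) 0 = length r"
| "rowlen (r # T) (Suc i) = rowlen T i"

lemma tab_first: "tab T \<Longrightarrow> sorted_wrt (<) (first T)"
  by (cases T) auto

text \<open>Bumping by columns. Under \<open>special\<close>, \<open>j\<close> is the column of
  \<open>x\<close>, whose entry stays the same, and \<open>y\<close> sits one column further
  right.\<close>

lemma bump_nth:
  assumes "bump r x y r'"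
  obtains j where "j < length r" "r' ! j = x" "\<And>i. i \<noteq> j \<Longrightarrow> r' ! i = r ! i" "\<And>i. i < j \<Longrightarrow> r ! i < x"
    "r ! j = y \<or> r ! j = x \<and> y = x + 1 \<and> Suc j < length r \<and> r ! Suc j = y"
  using assms
proof (cases rule: bump.cases)
  case (normal a z)
  then show ?thesis
    by (intro that[of "length a"]) (auto simp: nth_append nth_Cons split: nat.splits)
next
  case (special a z)
  then show ?thesis
    by (intro that[of "length a"]) (auto simp: nth_append)
qed

text \<open>The bumping path moves weakly to the left: \<open>y\<close> enters the next row in a
  column not beyond \<open>j\<close>, and there the upper row holds at most
  \<open>x < y\<close>.\<close>

lemma below_app:
  assumes "bump r x y r'" "sorted_wrt (<) r" "below r s" "\<forall>e\<in>set s. e < y"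
  shows "below r' (s @ [y])"
proof -
  obtain j where j: "j < length r" "r' ! j = x" "\<And>i. i \<noteq> j \<Longrightarrow> r' ! i = r ! i"
    "r ! j = y \<or> r ! j = x \<and> y = x + 1 \<and> Suc j < length r \<and> r ! Suc j = y"
    using bump_nth[OF assms(1)] by metis
  have xy: "x < y" using bump_less[OF assms(1)] .
  \<comment> \<open>Otherwise \<open>r ! j < s ! j < y\<close>, impossible for
    \<open>r ! j = y\<close> and, by integrality, for \<open>r ! j = y - 1\<close>.\<close>
  have "length s \<le> j"
  proof (rule ccontr)
    assume "\<not> length s \<le> j"
    then have "s ! j < y" "r ! j < s ! j" using assms by (auto simp: below_def)
    then show False using j(4) by auto
  qed
  have s': "sorted_wrt (<) r'" using bump_sorted assms(1,2) by simp
  have l: "length r' = length r" using bump_length assms(1) .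
  show ?thesis unfolding below_def
  proof (intro conjI allI impI)
    show "length (s @ [y]) \<le> length r'" using \<open>length s \<le> j\<close> j l by simp
    fix i assume i: "i < length (s @ [y])"
    show "r' ! i < (s @ [y]) ! i"
    proof (cases "i < length s")
      case True
      then have "r ! i < s ! i" using assms(3) by (simp add: below_def)
      then show ?thesis using True j(2,3) \<open>length s \<le> j\<close> by (simp add: nth_append)
    next
      case False
      then have "i = length s" using i by simp
      moreover have "r' ! i \<le> x"
        using sorted_wrt_nth_less[OF s', of i j] j(1,2) \<open>length s \<le> j\<close> \<open>i = length s\<close> l
        by (cases "i = j") auto
      ultimately show ?thesis using xy by simp
    qed
  qed
qed

text \<open>As in \<open>below_app\<close>, \<open>y\<close> lands in a column
  \<open>p \<le> j\<close>, under an entry at most \<open>x\<close>. In the other columns the upper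
  row does not grow and the lower row stays the same.\<close>

lemma below_bump:
  assumes "bump r x y r'" "sorted_wrt (<) r" "below r s" "bump s y y2 s'" "sorted_wrt (<) s"
  shows "below r' s'"
proof -
  obtain j where j: "j < length r" "r' ! j = x" "\<And>i. i \<noteq> j \<Longrightarrow> r' ! i = r ! i"
    "r ! j = y \<or> r ! j = x \<and> y = x + 1 \<and> Suc j < length r \<and> r ! Suc j = y"
    using bump_nth[OF assms(1)] by metis
  obtain p where p: "p < length s" "s' ! p = y" "\<And>i. i \<noteq> p \<Longrightarrow> s' ! i = s ! i" "\<And>i. i < p \<Longrightarrow> s ! i < y"
    using bump_nth[OF assms(4)] by metis
  have xy: "x < y" using bump_less[OF assms(1)] .
  have s': "sorted_wrt (<) r'" using bump_sorted assms(1,2) by simp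
  have l: "length r' = length r" "length s' = length s" using bump_length assms by auto
  have "p \<le> j"
  proof (rule ccontr)
    assume "\<not> p \<le> j"
    then have "s ! j < y" "r ! j < s ! j" using assms(3) p by (auto simp: below_def)
    then show False using j(4) by auto
  qed
  show ?thesis unfolding below_def
  proof (intro conjI allI impI)
    show "length s' \<le> length r'" using assms(3) l by (simp add: below_def)
    fix i assume i: "i < length s'"
    have rs: "r ! i < s ! i" using assms(3) i l by (simp add: below_def)
    show "r' ! i < s' ! i"
    proof (cases "i = p")
      case False
      have "r' ! i \<le> r ! i" using j xy by (cases "i = j") auto
      then show ?thesis using rs p(3)[OF False] by simp
    next
      case True
      have "r' ! i \<le> x"
        using sorted_wrt_nth_less[OF s', of i j] j(1,2) \<open>p \<le> j\<close> True l
        by (cases "i = j") auto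
      then show ?thesis using True p(2) xy by simp
    qed
  qed
qed

text \<open>Undoing the bump can raise the upper row only in column \<open>j\<close>, to
  \<open>y\<close>. If \<open>s\<close> reached that column, the entry above the appended
  \<open>y\<close> would already exceed \<open>y\<close>.\<close>

lemma below_app_rev:
  assumes "bump r x y r'" "sorted_wrt (<) r" "below r' (s @ [y])" "\<forall>e\<in>set s. e < y"
  shows "below r s"
proof -
  obtain j where j: "j < length r" "r' ! j = x" "\<And>i. i \<noteq> j \<Longrightarrow> r' ! i = r ! i"
    "r ! j = y \<or> r ! j = x \<and> y = x + 1 \<and> Suc j < length r \<and> r ! Suc j = y"
    using bump_nth[OF assms(1)] by metis
  have l: "length r' = length r" using bump_length assms(1) .
  have b: "length s < length r" "\<And>i. i < length s \<Longrightarrow> r' ! i < s ! i" "r' ! length s < y"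
    using assms(3) l by (auto simp: below_def nth_append less_Suc_eq split: if_splits)
  show ?thesis unfolding below_def
  proof (intro conjI allI impI)
    show "length s \<le> length r" using b by simp
    fix i assume i: "i < length s"
    show "r ! i < s ! i"
    proof (cases "i = j \<and> r ! j = y")
      case False
      then show ?thesis using b(2)[OF i] j by (cases "i = j") auto
    next
      case True
      then have "y < r ! length s" using sorted_wrt_nth_less[OF assms(2), of i "length s"] i b by simp
      then show ?thesis using b(3) j(3)[of "length s"] True i by simp
    qed
  qed
qed

text \<open>Only column \<open>j\<close> is critical, when its upper entry is raised to
  \<open>y\<close>. To the right of \<open>j\<close> the row \<open>r'\<close> exceeds
  \<open>y\<close>, so \<open>y\<close> lies in a column \<open>p \<le> j\<close> of
  \<open>s'\<close>. For \<open>p < j\<close> strictness of \<open>s'\<close> suffices; for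
  \<open>p = j\<close> undoing the lower bump raises the entry to \<open>y2\<close>.\<close>

lemma below_bump_rev:
  assumes "bump r x y r'" "sorted_wrt (<) r" "below r' s'" "bump s y y2 s'" "sorted_wrt (<) s"
  shows "below r s"
proof -
  obtain j where j: "j < length r" "r' ! j = x" "\<And>i. i \<noteq> j \<Longrightarrow> r' ! i = r ! i"
    "r ! j = y \<or> r ! j = x \<and> y = x + 1 \<and> Suc j < length r \<and> r ! Suc j = y"
    using bump_nth[OF assms(1)] by metis
  obtain p where p: "p < length s" "s' ! p = y" "\<And>i. i \<noteq> p \<Longrightarrow> s' ! i = s ! i"
    "s ! p = y2 \<or> s ! p = y \<and> y2 = y + 1 \<and> Suc p < length s \<and> s ! Suc p = y2"
    using bump_nth[OF assms(4)] by metis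
  have y2: "y < y2" using bump_less[OF assms(4)] .
  have s': "sorted_wrt (<) s'" using bump_sorted assms(4,5) by simp
  have l: "length r' = length r" "length s' = length s" using bump_length assms by auto
  have b: "length s \<le> length r" "\<And>i. i < length s \<Longrightarrow> r' ! i < s' ! i"
    using assms(3) l by (auto simp: below_def)
  show ?thesis unfolding below_def
  proof (intro conjI allI impI)
    show "length s \<le> length r" using b by simp
    fix i assume i: "i < length s"
    have ss: "s' ! i \<le> s ! i" using p y2 by (cases "i = p") auto
    show "r ! i < s ! i"
    proof (cases "i = j \<and> r ! j = y")
      case False
      then show ?thesis using b(2)[OF i] j ss by (cases "i = j") auto
    next
      case True
      have gt: "y < r' ! k" if "j < k" "k < length r" for k
        using sorted_wrt_nth_less[OF assms(2), of j k] True that j(3)[of k] by simp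
      have "p \<le> j" using gt[of p] b(2)[of p] p b(1) by force
      show ?thesis
      proof (cases "p = j")
        case False
        then show ?thesis
          using sorted_wrt_nth_less[OF s', of p j] \<open>p \<le> j\<close> True i l p by simp
      next
        case pj: True
        \<comment> \<open>Were the lower bump special, \<open>y + 1\<close> would stand in column
          \<open>Suc p\<close> of \<open>s'\<close>, under an entry of \<open>r'\<close> greater
          than \<open>y\<close>.\<close>
        have "s ! p = y2"
        proof (rule ccontr)
          assume "s ! p \<noteq> y2"
          then have "Suc p < length s" "s' ! Suc p = y + 1" using p by auto
          then show False using b gt[of "Suc p"] pj by force
        qed
        then show ?thesis using True pj y2 by simp
      qed
    qed
  qed
qed

section \<open>Shape, reading word and existence of insertions\<close>

lemma ins_first:
  assumes "ins T x i T'"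
  shows "first T' = first T @ [x] \<and> (\<forall>e\<in>set (first T). e < x) \<or> (\<exists>y. bump (first T) x y (first T'))"
  using assms by (cases rule: ins.cases) auto

lemma ins_tab: "ins T x i T' \<Longrightarrow> tab T \<Longrightarrow> tab T'"
proof (induction rule: ins.induct)
  case (Nil x)
  then show ?case by (simp add: below_def)
next
  case (app r x T)
  then show ?case by (force simp: below_def nth_append sorted_wrt_append)
next
  case (bump r x y r' T i T')
  have "below r' (first T')"
    using ins_first[OF bump.hyps(2)] below_app[OF bump.hyps(1)] below_bump[OF bump.hyps(1)] bump.prems
      tab_first by auto
  then show ?case using bump bump_not_Nil bump_sorted by simp
qed

lemma ins_set: "ins T x i T' \<Longrightarrow> set (concat T') = insert x (set (concat T))"
proof (induction rule: ins.induct)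
  case (bump r x y r' T i T')
  then show ?case using bump_set[OF bump.hyps(1)] by auto
qed auto

lemma ins_length: "ins T x i T' \<Longrightarrow> length (concat (rev T')) = Suc (length (concat (rev T)))"
  by (induction rule: ins.induct) (auto simp: bump_length)

lemma ins_rowlen: "ins T x i T' \<Longrightarrow> rowlen T' = (rowlen T)(i := Suc (rowlen T i))"
proof (induction rule: ins.induct)
  case (Nil x)
  have "rowlen [[x]] j = ((rowlen ([] :: int list list))(0 := Suc 0)) j" for j by (cases j) auto
  then show ?case by auto
next
  case (app r x T)
  have "rowlen ((r @ [x]) # T) j = ((rowlen (r # T))(0 := Suc (rowlen (r # T) 0))) j" for j
    by (cases j) auto
  then show ?case by auto
next
  case (bump r x y r' T i T')
  have "rowlen (r' # T') j = ((rowlen (r # T))(Suc i := Suc (rowlen (r # T) (Suc i)))) j" for j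
    by (cases j) (use bump bump_length in auto)
  then show ?case by auto
qed

text \<open>The reading word ends with the top row. There \<open>bump_wequiv\<close> turns
  \<open>r @ [x]\<close> into \<open>y # r'\<close>, which places \<open>y\<close> directly behind
  the reading word of the lower rows, ready for the next insertion.\<close>

lemma ins_wequiv:
  "ins T x i T' \<Longrightarrow> set (concat T) \<subseteq> {1..int n} \<Longrightarrow> x \<in> {1..int n} \<Longrightarrow>
    wequiv n (concat (rev T) @ [x]) (concat (rev T'))"
proof (induction rule: ins.induct)
  case (Nil x)
  then show ?case by (simp add: wequiv_refl pos_letters)
next
  case (app r x T)
  have "set (concat (rev T) @ r @ [x]) \<subseteq> {1..int n}" using app.prems by auto
  then have "set (concat (rev T) @ r @ [x]) \<subseteq> letters n" using letters_pos by blast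
  then show ?case using wequiv_refl by simp
next
  case (bump r x y r' T i T')
  have p: "set r \<subseteq> {1..int n}" "set (concat T) \<subseteq> {1..int n}" "y \<in> {1..int n}" "set r' \<subseteq> {1..int n}"
    using bump.prems bump_mem[OF bump.hyps(1)] bump_set[OF bump.hyps(1)] by auto
  then have l: "set r' \<subseteq> letters n" "set (concat (rev T)) \<subseteq> letters n" using letters_pos by fastforce+
  have "wequiv n (concat (rev T) @ (r @ [x])) (concat (rev T) @ (y # r'))"
    by (intro wequiv_append wequiv_refl l bump_wequiv[OF bump.hyps(1) p(1) bump.prems(2)])
  also have "wequiv n ((concat (rev T) @ [y]) @ r') (concat (rev T') @ r')"
    by (intro wequiv_append wequiv_refl l bump.IH p)
  then have "wequiv n (concat (rev T) @ (y # r')) (concat (rev T') @ r')" by simp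
  finally show ?case by simp
qed

lemma ins_red:
  assumes "ins T x i T'" "set (concat T') \<subseteq> {1..int n}"
  shows "red n (concat (rev T) @ [x] @ s) \<longleftrightarrow> red n (concat (rev T') @ s)"
proof -
  have p: "set (concat T) \<subseteq> {1..int n}" "x \<in> {1..int n}" using ins_set[OF assms(1)] assms(2) by auto
  show ?thesis
  proof (cases "set s \<subseteq> letters n")
    case True
    then have "wequiv n ((concat (rev T) @ [x]) @ s) (concat (rev T') @ s)"
      by (intro wequiv_append ins_wequiv[OF assms(1) p] wequiv_refl)
    moreover have "length ((concat (rev T) @ [x]) @ s) = length (concat (rev T') @ s)"
      using ins_length[OF assms(1)] by simp
    ultimately show ?thesis
      using red_wequiv[of n "(concat (rev T) @ [x]) @ s" "concat (rev T') @ s"]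
        red_wequiv[of n "concat (rev T') @ s" "(concat (rev T) @ [x]) @ s"] wequiv_sym by auto
  next
    case False
    then show ?thesis by (auto simp: red_def)
  qed
qed

text \<open>Reducedness is inherited downwards: after a bump, the lower rows followed by
  \<open>y\<close> form a prefix of an equivalent word of the same length.\<close>

lemma ins_exists_forward:
  assumes "tab T" "red n (concat (rev T) @ [x])" "set (concat T) \<subseteq> {1..int n}" "x \<in> {1..int n}"
  shows "\<exists>i T'. ins T x i T'"
  using assms
proof (induction T arbitrary: x)
  case Nil
  then show ?case using ins.Nil by blast
next
  case (Cons r T)
  show ?case
  proof (cases "\<forall>e\<in>set r. e < x")
    case True
    then show ?thesis using Cons.prems ins.app by fastforce
  next
    case False
    have rx: "red n (concat (rev T) @ (r @ [x]))" using Cons.prems by simp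
    obtain y r' where b: "bump r x y r'"
      using bump_exists_forward[of r n x] red_suffix[OF rx] Cons.prems False by auto
    have l: "set (concat (rev T)) \<subseteq> letters n" using rx by (auto simp: red_def)
    have y: "y \<in> {1..int n}" using bump_mem[OF b] Cons.prems by auto
    have "wequiv n (concat (rev T) @ (r @ [x])) (concat (rev T) @ (y # r'))"
      using Cons.prems by (intro wequiv_append wequiv_refl l bump_wequiv[OF b]) auto
    then have "red n ((concat (rev T) @ [y]) @ r')"
      by (auto intro: red_wequiv[OF rx] simp: bump_length[OF b])
    then have "red n (concat (rev T) @ [y])" by (rule red_prefix)
    then obtain i T' where "ins T y i T'" using Cons.IH[of y] Cons.prems y by auto
    then show ?thesis using ins.bump[OF b] by blast
  qed
qed

text \<open>The last condition says that row \<open>i\<close> ends in a corner. Removing it is done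
  from the bottom upwards: the letter released by the lower rows is pushed back into the row
  above.\<close>

lemma ins_exists_backward:
  assumes "tab T'" "red n (concat (rev T'))" "set (concat T') \<subseteq> {1..int n}"
    and "rowlen T' (Suc i) < rowlen T' i"
  shows "\<exists>T x. ins T x i T' \<and> tab T"
  using assms
proof (induction T' arbitrary: i)
  case Nil
  then show ?case by simp
next
  case (Cons r' S')
  show ?case
  proof (cases i)
    case 0
    obtain r x where r: "r' = r @ [x]" using Cons.prems(1) by (cases r' rule: rev_cases) auto
    have len: "length (first S') \<le> length r" using Cons.prems(4) 0 r by (cases S') auto
    show ?thesis
    proof (cases "r = []")
      case True
      then have "S' = []" using len Cons.prems(1) by (cases S') auto
      then have "ins [] x i (r' # S')" using ins.Nil 0 r True by simp
      then show ?thesis by (metis tab.simps(1))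
    next
      case False
      have "sorted_wrt (<) r" "\<forall>e\<in>set r. e < x" using Cons.prems(1) r by (auto simp: sorted_wrt_append)
      moreover have "below r (first S')"
        using Cons.prems(1) len r by (auto simp: below_def nth_append)
      ultimately have "ins (r # S') x i (r' # S') \<and> tab (r # S')"
        using ins.app[of r x S'] False 0 r Cons.prems(1) by simp
      then show ?thesis by blast
    qed
  next
    case (Suc k)
    have "red n (concat (rev S') @ r')" using Cons.prems(2) by simp
    then have "red n (concat (rev S'))" by (rule red_prefix)
    then obtain S y where S: "ins S y k S'" "tab S"
      using Cons.IH[of k] Cons.prems Suc by auto
    have p: "y \<in> {1..int n}" using ins_set[OF S(1)] Cons.prems(3) by auto
    have "red n (concat (rev S) @ (y # r'))"
      using ins_red[OF S(1), of n r'] Cons.prems(2,3) by simp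
    then have yr: "red n (y # r')" by (rule red_suffix)
    \<comment> \<open>\<open>y\<close> was either appended to this row or bumped into it. The entry
      of \<open>r'\<close> above it is therefore smaller than \<open>y\<close>, which is what
      \<open>bump_exists_backward\<close> asks for.\<close>
    have "y \<in> set (first S')" using ins_first[OF S(1)] bump_mem by auto
    then obtain j where "j < length (first S')" "first S' ! j = y" by (auto simp: in_set_conv_nth)
    then have "r' ! j < y" "j < length r'" using Cons.prems(1) by (auto simp: below_def)
    then obtain x r where b: "bump r x y r'"
      using bump_exists_backward[of r' n y] yr Cons.prems p by (auto dest: nth_mem)
    have sr: "sorted_wrt (<) r" using bump_sorted[OF b] Cons.prems(1) by simp
    have "below r (first S)"
      using ins_first[OF S(1)] below_app_rev[OF b sr] below_bump_rev[OF b sr] tab_first[OF S(2)]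
        Cons.prems(1) by auto
    then have "tab (r # S)" using S sr bump_not_Nil[OF b] by simp
    then show ?thesis using ins.bump[OF b S(1)] Suc by blast
  qed
qed

lemma tab_rowlen: "tab T \<Longrightarrow> rowlen T (Suc i) \<le> rowlen T i"
proof (induction T arbitrary: i)
  case (Cons r T)
  then show ?case by (cases i; cases T) (auto simp: below_def)
qed simp

section \<open>The correspondence for whole words\<close>

inductive egr :: "int list \<Rightarrow> int list list \<Rightarrow> nat list \<Rightarrow> bool" where
  Nil: "egr [] [] []"
| snoc: "egr w T q \<Longrightarrow> ins T x i T' \<Longrightarrow> egr (w @ [x]) T' (q @ [i])"

inductive_cases egr_snoc_word: "egr (w @ [x]) T q"
inductive_cases egr_snoc_rec: "egr w T (q @ [i])"

lemma egr_length: "egr w T q \<Longrightarrow> length w = length q"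
  by (induction rule: egr.induct) auto

lemma egr_length_reading: "egr w T q \<Longrightarrow> length (concat (rev T)) = length w"
  by (induction rule: egr.induct) (use ins_length in auto)

lemma egr_set: "egr w T q \<Longrightarrow> set (concat T) = set w"
proof (induction rule: egr.induct)
  case (snoc w T q x i T')
  then show ?case using ins_set[OF snoc.hyps(2)] by simp
qed simp

lemma egr_det_forward: "egr w T q \<Longrightarrow> egr w T' q' \<Longrightarrow> T = T' \<and> q = q'"
proof (induction arbitrary: T' q' rule: egr.induct)
  case Nil
  then show ?case by (auto elim: egr.cases)
next
  case (snoc w T q x i S)
  from snoc.prems show ?case
    by (rule egr_snoc_word) (use snoc ins_det_forward in blast)+
qed

lemma egr_det_backward: "egr w T q \<Longrightarrow> egr w' T q \<Longrightarrow> w = w'"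
proof (induction arbitrary: w' rule: egr.induct)
  case Nil
  then show ?case by (auto elim: egr.cases)
next
  case (snoc w T q x i S)
  from snoc.prems show ?case
    by (rule egr_snoc_rec) (use snoc ins_det_backward in blast)+
qed

text \<open>The counts of a prefix of \<open>q\<close> are the row lengths of the tableau reached
  there, and these decrease weakly; hence the lattice property.\<close>

lemma egr_props:
  assumes "egr w T q" "set w \<subseteq> {1..int n}"
  shows "tab T \<and> wequiv n w (concat (rev T)) \<and> set (concat T) = set w \<and>
    rowlen T = count_list q \<and> lattice_word q"
  using assms
proof (induction rule: egr.induct)
  case Nil
  then show ?case by (auto simp: wequiv_refl lattice_word_def)
next
  case (snoc w T q x i T')
  have IH: "tab T" "wequiv n w (concat (rev T))" "set (concat T) = set w"
    "rowlen T = count_list q" "lattice_word q" using snoc by auto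
  have x: "x \<in> {1..int n}" "set w \<subseteq> {1..int n}" using snoc.prems by auto
  have t: "tab T'" using ins_tab[OF snoc.hyps(2) IH(1)] .
  have "wequiv n [x] [x]" using x by (simp add: wequiv_refl pos_letters)
  then have "wequiv n (w @ [x]) (concat (rev T) @ [x])" using IH by (intro wequiv_append) auto
  also have "wequiv n (concat (rev T) @ [x]) (concat (rev T'))"
    using ins_wequiv[OF snoc.hyps(2)] IH(3) x by simp
  finally have "wequiv n (w @ [x]) (concat (rev T'))" .
  moreover have "set (concat T') = set (w @ [x])" using ins_set[OF snoc.hyps(2)] IH(3) by simp
  moreover have rl: "rowlen T' = count_list (q @ [i])"
    using ins_rowlen[OF snoc.hyps(2)] IH(4) by (auto simp: fun_eq_iff)
  moreover have "lattice_word (q @ [i])"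
    unfolding lattice_word_snoc using IH(5) tab_rowlen[OF t] rl by simp
  ultimately show ?case using t by simp
qed

lemma egr_exists_forward:
  assumes "red n w" "set w \<subseteq> {1..int n}"
  shows "\<exists>T q. egr w T q"
  using assms
proof (induction w rule: rev_induct)
  case Nil
  then show ?case using egr.Nil by blast
next
  case (snoc x w)
  then obtain T q where e: "egr w T q" using red_prefix by fastforce
  have p: "tab T" "wequiv n w (concat (rev T))" "set (concat T) = set w" "rowlen T = count_list q"
    using egr_props[OF e, of n] snoc.prems by auto
  have "length (concat (rev T)) = length w" using egr_length_reading[OF e] .
  moreover have "wequiv n [x] [x]" using snoc.prems by (simp add: wequiv_refl pos_letters)
  then have "wequiv n (w @ [x]) (concat (rev T) @ [x])" using p by (intro wequiv_append) auto
  ultimately have "red n (concat (rev T) @ [x])" by (auto intro: red_wequiv[OF snoc.prems(1)])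
  then obtain i T' where "ins T x i T'" using ins_exists_forward[of T n x] p snoc.prems by auto
  then show ?case using egr.snoc[OF e] by blast
qed

text \<open>The last letter of \<open>q\<close> names the row to shorten; the lattice condition on
  the remaining prefix says that this row ends in a corner.\<close>

lemma egr_exists_backward:
  assumes "tab T" "red n (concat (rev T))" "set (concat T) \<subseteq> {1..int n}"
    and "lattice_word q" "rowlen T = count_list q"
  shows "\<exists>w. egr w T q"
  using assms
proof (induction q arbitrary: T rule: rev_induct)
  case Nil
  then have "rowlen T 0 = 0" by simp
  then have "T = []" using Nil.prems(1) by (cases T) auto
  then show ?case using egr.Nil by blast
next
  case (snoc i q)
  have lat: "lattice_word q" using lattice_word_prefix snoc.prems(4) .
  then have "count_list q (Suc i) \<le> count_list q i" using lattice_wordD[of q "[]"] by simp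
  then have "rowlen T (Suc i) < rowlen T i" using snoc.prems(5) by simp
  then obtain S x where S: "ins S x i T" "tab S" using ins_exists_backward snoc.prems by blast
  have "red n (concat (rev S) @ [x])" using ins_red[OF S(1) snoc.prems(3), of "[]"] snoc.prems by simp
  then have "red n (concat (rev S))" by (rule red_prefix)
  moreover have "set (concat S) \<subseteq> {1..int n}" using ins_set[OF S(1)] snoc.prems(3) by auto
  moreover have "rowlen S = count_list q"
  proof
    fix j
    have "((rowlen S)(i := Suc (rowlen S i))) j = count_list (q @ [i]) j"
      using fun_cong[OF ins_rowlen[OF S(1)]] fun_cong[OF snoc.prems(5)] by metis
    then show "rowlen S j = count_list q j" by (cases "j = i") auto
  qed
  ultimately obtain w where "egr w S q" using snoc.IH[of S] S(2) lat by blast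
  then show ?case using egr.snoc[OF _ S(1)] by blast
qed

lemma egr_descents:
  assumes "egr w T q" "Suc j < length w"
  shows "(w ! j < w ! Suc j \<longrightarrow> q ! Suc j \<le> q ! j) \<and> (w ! Suc j < w ! j \<longrightarrow> q ! j < q ! Suc j)"
  using assms
proof (induction arbitrary: j rule: egr.induct)
  case (snoc w T q x i T')
  have len: "length w = length q" using egr_length snoc.hyps(1) .
  show ?case
  proof (cases "Suc j < length w")
    case True
    then show ?thesis using snoc.IH[of j] len by (simp add: nth_append)
  next
    case False
    then have j: "Suc j = length w" using snoc.prems by simp
    from snoc.hyps(1) show ?thesis
    proof (cases rule: egr.cases)
      case (snoc w0 T0 q0 x0 i0)
      then show ?thesis
        using j len ins_mono_up[OF snoc(4) \<open>ins T x i T'\<close>] ins_mono_down[OF snoc(4) \<open>ins T x i T'\<close>]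
        by (auto simp: nth_append)
    qed (use j in simp)
  qed
qed simp

text \<open>Equal neighbours would form a square, so exactly one of the two comparisons holds and
  the implications of \<open>egr_descents\<close> can be reversed.\<close>

lemma egr_descents_red:
  assumes "egr w T q" "Suc j < length w" "red n w"
  shows "w ! j < w ! Suc j \<longleftrightarrow> q ! Suc j \<le> q ! j" "w ! Suc j < w ! j \<longleftrightarrow> q ! j < q ! Suc j"
proof -
  have "w ! j \<noteq> w ! Suc j"
  proof
    assume "w ! j = w ! Suc j"
    then have "w = take j w @ w ! j # w ! j # drop (Suc (Suc j)) w"
      using assms(2) by (metis Cons_nth_drop_Suc Suc_lessD append_take_drop_id)
    then show False using assms(3) red_no_square by metis
  qed
  then show "w ! j < w ! Suc j \<longleftrightarrow> q ! Suc j \<le> q ! j" "w ! Suc j < w ! j \<longleftrightarrow> q ! j < q ! Suc j"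
    using egr_descents[OF assms(1,2)] by auto
qed

section \<open>Primed tableaux and lattice words\<close>

definition part :: "nat list \<Rightarrow> nat \<Rightarrow> nat" where
  "part lam i = (if i < length lam then lam ! i else 0)"

text \<open>\<open>Suc L\<close> is the letter occupying the strip. For even \<open>L\<close> it is
  primed and the strip is vertical, at most one cell per row; for odd \<open>L\<close> the strip is
  horizontal, which is interlacing of row lengths. Emptied rows stay as zeros, so all shapes in one
  recursion have the same number of rows.\<close>

definition strips :: "nat \<Rightarrow> nat \<Rightarrow> nat list \<Rightarrow> nat list set" where
  "strips L m lam = {mu. length mu = length lam \<and> sorted_wrt (\<ge>) mu \<and>
     (\<forall>i. part mu i \<le> part lam i) \<and> sum_list lam = sum_list mu + m \<and>
     (if even L then \<forall>i. part lam i \<le> Suc (part mu i) else \<forall>i. part lam (Suc i) \<le> part mu i)}"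

text \<open>The alphabet may also end in a primed letter, so that letters can be removed one at a
  time.\<close>

definition ptab :: "nat \<Rightarrow> nat list \<Rightarrow> nat list list set" where
  "ptab L lam = {T. map length T = lam \<and>
       (\<forall>r\<in>set T. set r \<subseteq> {1 .. L}) \<and>
       (\<forall>r\<in>set T. sorted r) \<and>
       (\<forall>i j. Suc i < length T \<and> j < length (T ! Suc i) \<longrightarrow> T ! i ! j \<le> T ! Suc i ! j) \<and>
       (\<forall>i j j'. i < length T \<and> j < length (T ! i) \<and> j' < length (T ! i) \<and> j \<noteq> j' \<and>
                 T ! i ! j = T ! i ! j' \<longrightarrow> even (T ! i ! j)) \<and>
       (\<forall>i i' j. i < length T \<and> i' < length T \<and> j < length (T ! i) \<and> j < length (T ! i') \<and>
                 i \<noteq> i' \<and> T ! i ! j = T ! i' ! j \<longrightarrow> odd (T ! i ! j))}"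

text \<open>The content c lists the multiplicities of the letters in decreasing order of the letters,
  so that restricting to all but the largest letter takes the tail of c.\<close>

definition ptab_content :: "nat list \<Rightarrow> nat list \<Rightarrow> nat list list set" where
  "ptab_content c lam =
     {T \<in> ptab (length c) lam. \<forall>e<length c. count_list (concat T) (Suc e) = rev c ! e}"

text \<open>Read as standard tableaux, these are the standardizations of the primed tableaux of
  shape \<open>lam\<close> and content \<open>c\<close>: cells of a primed letter are numbered
  downwards, cells of an unprimed letter from left to right.\<close>

definition lattice_content :: "nat list \<Rightarrow> nat list \<Rightarrow> nat list set" where
  "lattice_content c lam = {q. count_list q = part lam \<and> lattice_word q \<and> alt (<) (\<ge>) c q}"

lemma sorted_part: "sorted_wrt (\<ge>) lam \<longleftrightarrow> (\<forall>i. part lam (Suc i) \<le> part lam i)"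
proof
  assume "sorted_wrt (\<ge>) lam"
  then show "\<forall>i. part lam (Suc i) \<le> part lam i"
    by (auto simp: part_def sorted_wrt_iff_nth_less)
next
  assume h: "\<forall>i. part lam (Suc i) \<le> part lam i"
  have "part lam (i + k) \<le> part lam i" for i k
  proof (induction k)
    case (Suc k)
    then show ?case using h[rule_format, of "i + k"] by simp
  qed simp
  then have "part lam j \<le> part lam i" if "i < j" for i j
    using that by (metis le_add_diff_inverse less_imp_le_nat)
  then show "sorted_wrt (\<ge>) lam"
    unfolding sorted_wrt_iff_nth_less part_def by (metis (full_types) less_trans)
qed

lemma part_inject: "part lam = part mu \<Longrightarrow> length lam = length mu \<Longrightarrow> lam = mu"
  by (intro nth_equalityI) (auto simp: part_def fun_eq_iff split: if_splits)

lemma sum_list_part: "sum_list lam = sum (part lam) {..<length lam}"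
  by (simp add: sum_list_sum_nth part_def atLeast0LessThan)

lemma length_lattice_content:
  assumes "count_list q = part lam"
  shows "length q = sum_list lam"
proof -
  have "i < length lam" if "i \<in> set q" for i
    using that assms count_list_0_iff[of q i] by (auto simp: part_def fun_eq_iff split: if_splits)
  then have "sum (count_list q) {..<length lam} = length q"
    by (intro sum_count_set) auto
  then show ?thesis using assms by (simp add: sum_list_part)
qed

lemma finite_strips: "finite (strips L m lam)"
proof (rule finite_subset)
  show "strips L m lam \<subseteq> {mu. set mu \<subseteq> {..sum_list lam} \<and> length mu = length lam}"
    using member_le_sum_list by (fastforce simp: strips_def)
  show "finite {mu. set mu \<subseteq> {..sum_list lam} \<and> length mu = length lam}"
    by (rule finite_lists_length_eq) simp
qed

section \<open>Cutting the last segment off a lattice word\<close>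

lemma successively_le: "successively (\<ge>) (v :: nat list) \<longleftrightarrow> sorted_wrt (\<ge>) v"
  by (rule successively_conv_sorted_wrt) (auto intro: transpI)

lemma successively_less: "successively (<) (v :: 'a :: linorder list) \<longleftrightarrow> sorted_wrt (<) v"
  by (rule successively_conv_sorted_wrt) (auto intro: transpI)

lemma sorted_count_unique:
  assumes "sorted u" "sorted v" "count_list u = count_list v"
  shows "u = v"
proof -
  have "mset u = mset v" using assms(3) by (intro multiset_eqI) (simp add: count_mset)
  then show ?thesis using assms(1,2) properties_for_sort by metis
qed

lemma count_list_rev: "count_list (rev v) x = count_list v x"
  by (induction v) auto

text \<open>A monotone word is determined by its content once the direction is fixed; so the strip
  determines the segment.\<close>

lemma strip_word_unique:
  assumes "successively (if even L then (<) else (\<ge>)) u" "successively (if even L then (<) else (\<ge>)) v"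
    and "count_list u = count_list (v :: nat list)"
  shows "u = v"
proof (cases "even L")
  case True
  then show ?thesis
    using assms by (intro sorted_count_unique) (auto simp: successively_less strict_sorted_iff)
next
  case False
  have "rev u = rev v"
    using assms False
    by (intro sorted_count_unique) (auto simp: successively_le sorted_wrt_rev count_list_rev fun_eq_iff)
  then show ?thesis by simp
qed

lemma distinct_if_count_list: "(\<And>x. count_list xs x \<le> 1) \<Longrightarrow> distinct xs"
proof (induction xs)
  case (Cons a xs)
  have "count_list xs a = 0" using Cons.prems[of a] by simp
  moreover have "count_list xs x \<le> 1" for x
    using Cons.prems[of x] by (simp split: if_splits)
  ultimately show ?case using Cons.IH by (simp add: count_list_0_iff)
qed simp

lemma sorted_word_exists:
  "\<exists>v. sorted v \<and> count_list v = (\<lambda>i. if i < (l :: nat) then d i else 0)"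
proof (induction l)
  case 0
  show ?case by (rule exI[of _ "[]"]) auto
next
  case (Suc l)
  then obtain v where v: "sorted v" "count_list v = (\<lambda>i. if i < l then d i else 0)" by blast
  have "x < l" if "x \<in> set v" for x
    using that fun_cong[OF v(2), of x] count_list_0_iff[of v x] by (cases "x < l") auto
  then have "sorted (v @ replicate (d l) l)" using v(1) by (force simp: sorted_append)
  moreover have r: "count_list (replicate k l) i = (if i = l then k else 0)" for k i
    by (induction k) auto
  have "count_list (v @ replicate (d l) l) = (\<lambda>i. if i < Suc l then d i else 0)"
    by (rule ext) (auto simp: r v(2))
  ultimately show ?case by blast
qed

lemma strip_word_exists:
  assumes "mu \<in> strips L m lam"
  shows "\<exists>v. successively (if even L then (<) else (\<ge>)) v \<and>
    (\<forall>i. part lam i = part mu i + count_list v i)"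
proof -
  have mu: "part mu i \<le> part lam i" "even L \<Longrightarrow> part lam i \<le> Suc (part mu i)" for i
    using assms by (simp_all add: strips_def)
  obtain v where v: "sorted v"
    "count_list v = (\<lambda>i. if i < length lam then part lam i - part mu i else 0)"
    using sorted_word_exists[of "length lam" "\<lambda>i. part lam i - part mu i"] by blast
  have c: "part lam i = part mu i + count_list v i" for i
  proof -
    have "part lam i = 0" if "\<not> i < length lam" using that by (simp add: part_def)
    moreover have "count_list v i = (if i < length lam then part lam i - part mu i else 0)"
      by (simp only: v(2))
    ultimately show ?thesis using mu(1)[of i] by (cases "i < length lam") simp_all
  qed
  show ?thesis
  proof (cases "even L")
    case True
    have "count_list v i \<le> 1" for i using mu(2)[OF True, of i] c[of i] by simp
    then have "distinct v" by (rule distinct_if_count_list)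
    then show ?thesis using True v(1) c by (auto simp: successively_less strict_sorted_iff)
  next
    case False
    have "sorted_wrt (\<ge>) (rev v)" using v(1) by (simp add: sorted_wrt_rev)
    then show ?thesis using False c by (intro exI[of _ "rev v"]) (simp add: successively_le count_list_rev)
  qed
qed

lemma lattice_word_append:
  "lattice_word (u @ v) \<longleftrightarrow> lattice_word u \<and>
    (\<forall>p s. v = p @ s \<longrightarrow> (\<forall>i. count_list (u @ p) (Suc i) \<le> count_list (u @ p) i))"
proof
  assume h: "lattice_word (u @ v)"
  have "count_list (u @ p) (Suc i) \<le> count_list (u @ p) i" if "v = p @ s" for p s i
    using lattice_wordD[of "u @ p" s] h that by simp
  then show "lattice_word u \<and>
    (\<forall>p s. v = p @ s \<longrightarrow> (\<forall>i. count_list (u @ p) (Suc i) \<le> count_list (u @ p) i))"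
    using lattice_word_prefix[OF h] by blast
next
  assume h: "lattice_word u \<and>
    (\<forall>p s. v = p @ s \<longrightarrow> (\<forall>i. count_list (u @ p) (Suc i) \<le> count_list (u @ p) i))"
  show "lattice_word (u @ v)"
    unfolding lattice_word_def
  proof (intro allI impI)
    fix p s i assume "u @ v = p @ s"
    then consider t where "u = p @ t" | t where "p = u @ t" "v = t @ s"
      by (auto simp: append_eq_append_conv2)
    then show "count_list p (Suc i) \<le> count_list p i"
    proof cases
      case 1
      then show ?thesis using h lattice_wordD by blast
    next
      case 2
      then show ?thesis using h by blast
    qed
  qed
qed

text \<open>Let \<open>Suc i\<close> occur in the prefix \<open>p\<close>. In a vertical strip the
  segment increases, so every \<open>i\<close> has been read already and its count is the final one.
  In a horizontal strip the letters \<open>i\<close> of \<open>u\<close> alone outnumber all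
  \<open>Suc i\<close>, by interlacing.\<close>

lemma lattice_word_strip:
  assumes "mu \<in> strips L m lam" "sorted_wrt (\<ge>) lam" "lattice_word u" "count_list u = part mu"
    and "successively (if even L then (<) else (\<ge>)) v" "\<And>i. part lam i = part mu i + count_list v i"
  shows "lattice_word (u @ v)"
proof -
  have "count_list (u @ p) (Suc i) \<le> count_list (u @ p) i" if v: "v = p @ s" for p s i
  proof (cases "count_list p (Suc i) = 0")
    case True
    then show ?thesis using lattice_wordD[of u "[]" i] assms(3) by simp
  next
    case False
    have le: "count_list (u @ p) (Suc i) \<le> part lam (Suc i)"
      using assms(4,6) v by simp
    show ?thesis
    proof (cases "even L")
      case True
      have "Suc i \<in> set p" using False by (metis count_list_0_iff)
      moreover have "sorted_wrt (<) (p @ s)" using assms(5) True v by (simp add: successively_less)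
      ultimately have "\<forall>x\<in>set s. Suc i < x" by (auto simp: sorted_wrt_append)
      then have "i \<notin> set s" by auto
      then have "part lam i = count_list (u @ p) i" using assms(4,6) v by simp
      moreover have "part lam (Suc i) \<le> part lam i" using assms(2) sorted_part by blast
      ultimately show ?thesis using le by simp
    next
      case odd: False
      then have "part lam (Suc i) \<le> part mu i" using assms(1) by (simp add: strips_def)
      then show ?thesis using le assms(4) by simp
    qed
  qed
  then show ?thesis using lattice_word_append assms(3) by blast
qed

lemma strip_of_lattice_word:
  assumes "lattice_word (u @ v)" "count_list (u @ v) = part lam"
    and "successively (if even L then (<) else (\<ge>)) v"
  shows "\<exists>mu\<in>strips L (length v) lam. count_list u = part mu"
proof -
  define mu where "mu = map (count_list u) [0..<length lam]"
  have lam: "part lam i = count_list u i + count_list v i" for i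
    using assms(2) by (simp add: fun_eq_iff)
  have mu: "part mu i = count_list u i" for i
    using lam[of i] by (auto simp: mu_def part_def split: if_splits)
  have lat: "lattice_word u" using assms(1) lattice_word_prefix by blast
  have "sorted_wrt (\<ge>) mu"
    unfolding sorted_part mu using lattice_wordD[of u "[]"] lat by simp
  moreover have "part mu i \<le> part lam i" for i using lam mu by simp
  moreover have "sum_list lam = sum_list mu + length v"
    using length_lattice_content[OF assms(2)] length_lattice_content[of u mu, OF ext] mu by simp
  moreover have "part lam i \<le> Suc (part mu i)" if "even L" for i
  proof -
    have "distinct v" using assms(3) that by (simp add: successively_less strict_sorted_iff)
    then have "count_list v i \<le> 1" by (induction v) (auto simp: count_notin)
    then show ?thesis using lam mu by simp
  qed
  moreover have "part lam (Suc i) \<le> part mu i" if "odd L" for i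
  proof -
    \<comment> \<open>The weakly decreasing segment is cut before its first letter not above
      \<open>i\<close>. The prefix has read every \<open>Suc i\<close> and no \<open>i\<close> of
      the segment, so the lattice condition at this point is the interlacing inequality.\<close>
    let ?p = "takeWhile (\<lambda>x. i < x) v" and ?s = "dropWhile (\<lambda>x. i < x) v"
    have "sorted_wrt (\<ge>) v" using assms(3) that by (simp add: successively_le)
    then have "\<forall>x\<in>set ?s. x \<le> i"
    proof (induction v)
      case (Cons a v)
      then show ?case by (cases "i < a") fastforce+
    qed simp
    then have "Suc i \<notin> set ?s" by auto
    then have "count_list v (Suc i) = count_list ?p (Suc i)"
      by (metis add.right_neutral count_list_append count_notin takeWhile_dropWhile_id)
    moreover have "count_list ?p i = 0"
      by (metis count_notin less_irrefl set_takeWhileD)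
    moreover have "count_list (u @ ?p) (Suc i) \<le> count_list (u @ ?p) i"
      using lattice_wordD[of "u @ ?p" ?s i] assms(1) by simp
    ultimately show ?thesis using lam mu by simp
  qed
  ultimately have "mu \<in> strips L (length v) lam" by (simp add: strips_def mu_def)
  moreover have "count_list u = part mu" by (rule ext) (simp only: mu)
  ultimately show ?thesis by blast
qed

text \<open>The removed segment can be recovered from the two shapes, by
  \<open>strip_word_unique\<close>, and exists for every strip, by
  \<open>strip_word_exists\<close>.\<close>

lemma bij_lattice_content:
  assumes "sorted_wrt (\<ge>) lam"
  shows "bij_betw (\<lambda>q. take (length q - m) q) (lattice_content (m # c) lam)
    (\<Union>mu\<in>strips (length c) m lam. lattice_content c mu)" (is "bij_betw ?f ?A ?B")
proof -
  let ?S = "successively (if even (length c) then (<) else (\<ge>)) :: nat list \<Rightarrow> bool"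
  have split: "\<exists>u v. q = u @ v \<and> length v = m \<and> alt (<) (\<ge>) c u \<and> ?S v \<and> ?f q = u \<and>
     count_list (u @ v) = part lam \<and> lattice_word (u @ v)" if "q \<in> ?A" for q
    using that unfolding lattice_content_def by fastforce
  have "inj_on ?f ?A"
  proof (rule inj_onI)
    fix q q' assume q: "q \<in> ?A" "q' \<in> ?A" "?f q = ?f q'"
    obtain u v v' where uv: "q = u @ v" "q' = u @ v'" "?S v" "?S v'"
      "count_list (u @ v) = part lam" "count_list (u @ v') = part lam"
      using split[OF q(1)] split[OF q(2)] q(3) by metis
    have "count_list v = count_list v'"
    proof
      fix i show "count_list v i = count_list v' i"
        using fun_cong[OF uv(5), of i] fun_cong[OF uv(6), of i] by simp
    qed
    then show "q = q'" using strip_word_unique[OF uv(3,4)] uv by simp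
  qed
  moreover have "?f q \<in> ?B" if q: "q \<in> ?A" for q
  proof -
    obtain u v where uv: "q = u @ v" "length v = m" "alt (<) (\<ge>) c u" "?S v" "?f q = u"
      "count_list (u @ v) = part lam" "lattice_word (u @ v)" using split[OF q] by blast
    obtain mu where "mu \<in> strips (length c) m lam" "count_list u = part mu"
      using strip_of_lattice_word[OF uv(7,6,4)] uv(2) by blast
    then show ?thesis
      using uv lattice_word_prefix by (auto simp: lattice_content_def)
  qed
  moreover have "u \<in> ?f ` ?A" if "u \<in> ?B" for u
  proof -
    obtain mu where mu: "mu \<in> strips (length c) m lam" "count_list u = part mu" "lattice_word u"
      "alt (<) (\<ge>) c u" using \<open>u \<in> ?B\<close> by (auto simp: lattice_content_def)
    obtain v where v: "?S v" "\<And>i. part lam i = part mu i + count_list v i"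
      using strip_word_exists[OF mu(1)] by blast
    have cnt: "count_list (u @ v) = part lam" using mu(2) v(2) by (simp add: fun_eq_iff)
    have "sum_list lam = sum_list mu + m" using mu(1) by (simp add: strips_def)
    then have len: "length v = m"
      using length_lattice_content[OF cnt] length_lattice_content[OF mu(2)] by simp
    have "alt (<) (\<ge>) (m # c) (u @ v)" unfolding alt.simps using mu(4) v(1) len by blast
    then have "u @ v \<in> ?A"
      using lattice_word_strip[OF mu(1) assms mu(3,2) v] cnt by (simp add: lattice_content_def)
    moreover have "?f (u @ v) = u" using len by simp
    ultimately show ?thesis by (intro image_eqI[of u ?f "u @ v"]) simp_all
  qed
  ultimately show ?thesis unfolding bij_betw_def by blast
qed

section \<open>Removing the largest letter from a primed tableau\<close>

lemma sorted_row_split: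
  assumes "sorted r" "set r \<subseteq> {..Suc L}"
  shows "r = filter (\<lambda>e. e \<le> L) r @ replicate (length r - length (filter (\<lambda>e. e \<le> L) r)) (Suc L)"
  using assms
proof (induction r)
  case (Cons a r)
  show ?case
  proof (cases "a \<le> L")
    case True
    then show ?thesis using Cons by auto
  next
    case False
    then have a: "a = Suc L" using Cons.prems by auto
    then have "filter (\<lambda>e. e \<le> L) r = []" using Cons.prems by (fastforce simp: filter_empty_conv)
    then show ?thesis using Cons a by auto
  qed
qed simp

lemma sorted_row_nth:
  assumes "sorted r" "set r \<subseteq> {..Suc L}" "j < length r"
  shows "r ! j = (if j < length (filter (\<lambda>e. e \<le> L) r) then filter (\<lambda>e. e \<le> L) r ! j else Suc L)"
  using arg_cong[OF sorted_row_split[OF assms(1,2)], of "\<lambda>r. r ! j"] assms(3)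
  by (simp add: nth_append split: if_splits)

lemma count_list_filter: "P x \<Longrightarrow> count_list (filter P xs) x = count_list xs x"
  by (induction xs) auto

lemma length_concat_restrict:
  assumes "\<forall>r\<in>set T. set r \<subseteq> {..Suc L}"
  shows "sum_list (map length T) =
    sum_list (map length (map (filter (\<lambda>e. e \<le> L)) T)) + count_list (concat T) (Suc L)"
proof -
  have "filter (\<lambda>e. \<not> e \<le> L) (concat T) = filter ((=) (Suc L)) (concat T)"
    using assms by (intro filter_cong) fastforce+
  then have "length (concat T) =
      length (filter (\<lambda>e. e \<le> L) (concat T)) + count_list (concat T) (Suc L)"
    using sum_length_filter_compl[of "\<lambda>e. e \<le> L" "concat T"]
    by (simp add: count_list_eq_length_filter)
  then show ?thesis by (simp add: length_concat filter_concat comp_def)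
qed

lemma ptab_rows:
  assumes "T \<in> ptab L lam" "r \<in> set T"
  shows "sorted r" "set r \<subseteq> {1..L}"
  using assms by (simp_all add: ptab_def)

text \<open>If row \<open>Suc i\<close> kept a column that row \<open>i\<close> loses,
  \<open>Suc L\<close> would stand above a smaller letter; so a partition remains. Two removed cells
  in a row force \<open>Suc L\<close> to be even and two in a column force it to be odd, whence the
  kind of strip.\<close>

lemma ptab_restrict:
  assumes T: "T \<in> ptab (Suc L) lam" and lam: "sorted_wrt (\<ge>) lam"
  defines "T0 \<equiv> map (filter (\<lambda>e. e \<le> L)) T"
  shows "T0 \<in> ptab L (map length T0)"
    and "map length T0 \<in> strips L (count_list (concat T) (Suc L)) lam"
proof -
  have len: "length T = length lam" "\<And>i. i < length T \<Longrightarrow> length (T ! i) = lam ! i"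
    using T by (auto simp: ptab_def)
  have row: "sorted (T ! i)" "set (T ! i) \<subseteq> {1..Suc L}" if "i < length T" for i
    using ptab_rows[OF T nth_mem[OF that]] by simp_all
  have T0: "length T0 = length T" "\<And>i. i < length T \<Longrightarrow> T0 ! i = filter (\<lambda>e. e \<le> L) (T ! i)"
    by (simp_all add: T0_def)
  have le: "length (T0 ! i) \<le> length (T ! i)" if "i < length T" for i
    using T0(2)[OF that] by simp
  have small: "T0 ! i ! j \<le> L" if "i < length T" "j < length (T0 ! i)" for i j
    using nth_mem[OF that(2)] T0(2)[OF that(1)] by simp
  have nth: "T ! i ! j = (if j < length (T0 ! i) then T0 ! i ! j else Suc L)"
    if "i < length T" "j < length (T ! i)" for i j
    using sorted_row_nth[of "T ! i" L j] row[OF that(1)] that T0(2) by force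
  have nth0: "T0 ! i ! j = T ! i ! j" if "i < length T" "j < length (T0 ! i)" for i j
    using nth[of i j] that le[of i] by simp
  have dec: "length (T ! Suc i) \<le> length (T ! i)" if "Suc i < length T" for i
    using lam len that by (simp add: sorted_wrt_iff_nth_less)
  have col: "T ! i ! j \<le> T ! Suc i ! j" if "Suc i < length T" "j < length (T ! Suc i)" for i j
    using T that by (simp add: ptab_def)
  have dec0: "length (T0 ! Suc i) \<le> length (T0 ! i)" if i: "Suc i < length T" for i
  proof (rule ccontr)
    define j where "j = length (T0 ! i)"
    assume "\<not> length (T0 ! Suc i) \<le> length (T0 ! i)"
    then have j: "j < length (T0 ! Suc i)" by (simp add: j_def)
    then have "j < length (T ! Suc i)" using le[OF i] by simp
    moreover have "j < length (T ! i)" using calculation dec[OF i] by simp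
    ultimately have "Suc L \<le> T ! Suc i ! j" using nth[of i j] col[OF i, of j] i by (simp add: j_def)
    then show False using nth0[OF i j] small[OF i j] by simp
  qed
  have row_even: "even (T ! i ! j)" if "i < length T" "j < length (T ! i)" "j' < length (T ! i)"
    "j \<noteq> j'" "T ! i ! j = T ! i ! j'" for i j j'
    using T that unfolding ptab_def by blast
  have col_odd: "odd (T ! i ! j)" if "i < length T" "i' < length T" "j < length (T ! i)"
    "j < length (T ! i')" "i \<noteq> i'" "T ! i ! j = T ! i' ! j" for i i' j
    using T that unfolding ptab_def by blast
  have "\<forall>r\<in>set T0. set r \<subseteq> {1..L}" "\<forall>r\<in>set T0. sorted r"
    using T by (fastforce simp: T0_def ptab_def sorted_wrt_filter)+
  moreover have "T0 ! i ! j \<le> T0 ! Suc i ! j" if "Suc i < length T0" "j < length (T0 ! Suc i)" for i j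
  proof -
    have i: "Suc i < length T" using that T0 by simp
    show ?thesis
      using nth0[of i j] nth0[of "Suc i" j] i that(2) dec0[OF i] le[OF i] col[OF i, of j] by simp
  qed
  moreover have "even (T0 ! i ! j)" if "i < length T0" "j < length (T0 ! i)" "j' < length (T0 ! i)"
    "j \<noteq> j'" "T0 ! i ! j = T0 ! i ! j'" for i j j'
  proof -
    have i: "i < length T" using that T0 by simp
    have "T ! i ! j = T ! i ! j'" "j < length (T ! i)" "j' < length (T ! i)"
      using that nth0[OF i] le[OF i] by simp_all
    then have "even (T ! i ! j)" using row_even that(4) i by blast
    then show ?thesis using nth0[OF i that(2)] by simp
  qed
  moreover have "odd (T0 ! i ! j)" if "i < length T0" "i' < length T0" "j < length (T0 ! i)"
    "j < length (T0 ! i')" "i \<noteq> i'" "T0 ! i ! j = T0 ! i' ! j" for i i' j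
  proof -
    have i: "i < length T" "i' < length T" using that T0 by simp_all
    have "T ! i ! j = T ! i' ! j" "j < length (T ! i)" "j < length (T ! i')"
      using that nth0[OF i(1)] nth0[OF i(2)] le[OF i(1)] le[OF i(2)] by simp_all
    then have "odd (T ! i ! j)" using col_odd that(5) i by blast
    then show ?thesis using nth0[OF i(1) that(3)] by simp
  qed
  ultimately show "T0 \<in> ptab L (map length T0)" unfolding ptab_def by blast
  let ?mu = "map length T0"
  have pmu: "part ?mu i = (if i < length T then length (T0 ! i) else 0)" for i
    using T0(1) by (simp add: part_def)
  have plam: "part lam i = (if i < length T then length (T ! i) else 0)" for i
    using len by (simp add: part_def)
  have "sorted_wrt (\<ge>) ?mu"
    unfolding sorted_part pmu using dec0 by simp
  moreover have "part ?mu i \<le> part lam i" for i using le by (simp add: pmu plam)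
  moreover have "sum_list lam = sum_list ?mu + count_list (concat T) (Suc L)"
  proof -
    have "\<forall>r\<in>set T. set r \<subseteq> {..Suc L}" using T by (fastforce simp: ptab_def)
    moreover have "map length T = lam" using T by (simp add: ptab_def)
    ultimately show ?thesis using length_concat_restrict[of T L] by (simp only: T0_def)
  qed
  moreover have "part lam i \<le> Suc (part ?mu i)" if "even L" for i
  proof (rule ccontr)
    define j where "j = length (T0 ! i)"
    assume "\<not> part lam i \<le> Suc (part ?mu i)"
    then have i: "i < length T" and j: "Suc j < length (T ! i)"
      by (auto simp: pmu plam j_def split: if_splits)
    then have e: "T ! i ! j = Suc L" "T ! i ! Suc j = Suc L"
      using nth[OF i, of j] nth[OF i, of "Suc j"] by (simp_all add: j_def)
    have "even (T ! i ! j)"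
      using row_even[of i j "Suc j"] i j e by simp
    then show False using e that by simp
  qed
  moreover have "part lam (Suc i) \<le> part ?mu i" if "odd L" for i
  proof (rule ccontr)
    define j where "j = length (T0 ! i)"
    assume "\<not> part lam (Suc i) \<le> part ?mu i"
    then have i: "Suc i < length T" and j: "j < length (T ! Suc i)"
      by (auto simp: pmu plam j_def split: if_splits)
    have j': "j < length (T ! i)" using j dec[OF i] by simp
    have e: "T ! i ! j = Suc L" using nth[of i j] i j' by (simp add: j_def)
    then have "T ! Suc i ! j = Suc L"
      using col[OF i j] nth[OF i j] small[OF i, of j] by (auto split: if_splits)
    then have "odd (T ! i ! j)"
      using col_odd[of i "Suc i" j] i j j' e by simp
    then show False using e that by simp
  qed
  ultimately show "?mu \<in> strips L (count_list (concat T) (Suc L)) lam"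
    using len(1) T0(1) by (simp add: strips_def)
qed

lemma ptab_extend:
  assumes T0: "T0 \<in> ptab L mu" and mu: "mu \<in> strips L m lam" and lam: "sorted_wrt (\<ge>) lam"
  shows "\<exists>T\<in>ptab (Suc L) lam. map (filter (\<lambda>e. e \<le> L)) T = T0"
proof -
  define T where "T = map2 (\<lambda>r l. r @ replicate (l - length r) (Suc L)) T0 lam"
  have len0: "map length T0 = mu" "length T0 = length lam"
    using T0 mu by (auto simp: ptab_def strips_def)
  have lens: "length T = length lam" by (simp add: T_def len0)
  have Ti: "T ! i = T0 ! i @ replicate (lam ! i - length (T0 ! i)) (Suc L)" if "i < length lam" for i
    using that by (simp add: T_def len0)
  have l0: "length (T0 ! i) = mu ! i" if "i < length lam" for i
    using that len0 by auto
  have lm: "length mu = length lam" using mu by (simp add: strips_def)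
  have mule: "mu ! i \<le> lam ! i" if "i < length lam" for i
    using mu that lm by (auto simp: strips_def part_def split: if_splits dest!: spec[of _ i])
  have len: "length (T ! i) = lam ! i" if "i < length lam" for i
    using Ti[OF that] l0[OF that] mule[OF that] by simp
  have nth: "T ! i ! j = (if j < mu ! i then T0 ! i ! j else Suc L)"
    if "i < length lam" "j < lam ! i" for i j
    using Ti[OF that(1)] l0[OF that(1)] that by (simp add: nth_append)
  have row0: "sorted (T0 ! i)" "set (T0 ! i) \<subseteq> {1..L}" if "i < length lam" for i
  proof -
    have "T0 ! i \<in> set T0" using that len0 by simp
    then show "sorted (T0 ! i)" "set (T0 ! i) \<subseteq> {1..L}" using ptab_rows[OF T0] by simp_all
  qed
  have small: "T0 ! i ! j \<le> L" if "i < length lam" "j < mu ! i" for i j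
    using subsetD[OF row0(2)[OF that(1)] nth_mem, of j] l0[OF that(1)] that(2) by simp
  have mudec: "mu ! Suc i \<le> mu ! i" if "Suc i < length lam" for i
    using mu that lm by (simp add: strips_def sorted_wrt_iff_nth_less)
  have lamdec: "lam ! i' \<le> lam ! i" if "i < i'" "i' < length lam" for i i'
    using lam that by (simp add: sorted_wrt_iff_nth_less)
  have "map length T = lam" by (rule nth_equalityI) (use lens len in auto)
  moreover have "\<forall>r\<in>set T. set r \<subseteq> {1..Suc L} \<and> sorted r"
  proof
    fix r assume "r \<in> set T"
    then obtain i where i: "i < length lam" "r = T ! i" using lens by (auto simp: in_set_conv_nth)
    then show "set r \<subseteq> {1..Suc L} \<and> sorted r"
      using Ti[OF i(1)] row0[OF i(1)] by (fastforce simp: sorted_append)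
  qed
  moreover have "T ! i ! j \<le> T ! Suc i ! j" if "Suc i < length T" "j < length (T ! Suc i)" for i j
  proof -
    have i: "Suc i < length lam" "j < lam ! Suc i" using that lens len by auto
    then have j: "j < lam ! i" using lamdec[of i "Suc i"] by simp
    have c0: "T0 ! i ! j \<le> T0 ! Suc i ! j" if "j < mu ! Suc i"
      using T0 i len0 l0[OF i(1)] that by (simp add: ptab_def)
    show ?thesis
      using nth[OF i] nth[of i j] i j c0 mudec[OF i(1)] small[of i j] by (auto split: if_splits)
  qed
  moreover have "even (T ! i ! j)" if "i < length T" "j < length (T ! i)" "j' < length (T ! i)"
    "j \<noteq> j'" "T ! i ! j = T ! i ! j'" for i j j'
  proof -
    have i: "i < length lam" "j < lam ! i" "j' < lam ! i" using that lens len by auto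
    show ?thesis
    proof (cases "j < mu ! i")
      case True
      then have "T ! i ! j' \<le> L" using nth[OF i(1,2)] small[OF i(1)] that(5) by simp
      then have "j' < mu ! i" using nth[OF i(1,3)] by (auto split: if_splits)
      then have "T0 ! i ! j = T0 ! i ! j'" using True nth[OF i(1,2)] nth[OF i(1,3)] that(5) by simp
      then have "even (T0 ! i ! j)"
        using T0 i(1) len0(2) l0[OF i(1)] True \<open>j' < mu ! i\<close> that(4) unfolding ptab_def by auto
      then show ?thesis using nth[OF i(1,2)] True by simp
    next
      case False
      then have e: "T ! i ! j = Suc L" using nth[OF i(1,2)] by simp
      then have "\<not> j' < mu ! i" using nth[OF i(1,3)] small[OF i(1), of j'] that(5) by auto
      then have "Suc (mu ! i) < lam ! i" using False i that(4) by linarith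
      then have "odd L" using mu i(1) lm
        by (auto simp: strips_def part_def split: if_splits dest!: spec[of _ i])
      then show ?thesis using e by simp
    qed
  qed
  moreover have "odd (T ! i ! j)" if "i < length T" "i' < length T" "j < length (T ! i)"
    "j < length (T ! i')" "i \<noteq> i'" "T ! i ! j = T ! i' ! j" for i i' j
  proof -
    have i: "i < length lam" "i' < length lam" "j < lam ! i" "j < lam ! i'" using that lens len by auto
    show ?thesis
    proof (cases "j < mu ! i")
      case True
      then have "T ! i' ! j \<le> L" using nth[OF i(1,3)] small[OF i(1)] that(6) by simp
      then have j': "j < mu ! i'" using nth[OF i(2,4)] by (auto split: if_splits)
      then have "T0 ! i ! j = T0 ! i' ! j" using True nth[OF i(1,3)] nth[OF i(2,4)] that(6) by simp
      then have "odd (T0 ! i ! j)"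
        using T0 i len0(2) l0[OF i(1)] l0[OF i(2)] True j' that(5) unfolding ptab_def by auto
      then show ?thesis using nth[OF i(1,3)] True by simp
    next
      case False
      then have e: "T ! i ! j = Suc L" using nth[OF i(1,3)] by simp
      then have j': "\<not> j < mu ! i'" using nth[OF i(2,4)] small[OF i(2), of j] that(6) by auto
      \<comment> \<open>Both cells lie outside \<open>mu\<close> in column \<open>j\<close>. With
        rows \<open>a < b\<close>, an odd \<open>L\<close> would give
        \<open>j < lam ! b \<le> lam ! Suc a \<le> mu ! a \<le> j\<close>.\<close>
      have "even L"
      proof (rule ccontr)
        assume "odd L"
        then have s: "lam ! Suc k \<le> mu ! k" if "Suc k < length lam" for k
          using mu that lm by (auto simp: strips_def part_def split: if_splits dest!: spec[of _ k])
        have *: "lam ! b \<le> mu ! a" if "a < b" "b < length lam" for a b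
        proof -
          have "lam ! b \<le> lam ! Suc a" using lamdec[of "Suc a" b] that by (cases "Suc a = b") auto
          then show ?thesis using s[of a] that by simp
        qed
        show False
          using *[of i i'] *[of i' i] i False j' that(5) by (cases "i < i'") auto
      qed
      then show ?thesis using e by simp
    qed
  qed
  ultimately have "T \<in> ptab (Suc L) lam" unfolding ptab_def by blast
  moreover have "map (filter (\<lambda>e. e \<le> L)) T = T0"
  proof (rule nth_equalityI)
    show "length (map (filter (\<lambda>e. e \<le> L)) T) = length T0" using lens len0 by simp
    fix i assume "i < length (map (filter (\<lambda>e. e \<le> L)) T)"
    then have i: "i < length lam" using lens by simp
    have "filter (\<lambda>e. e \<le> L) (T0 ! i) = T0 ! i" using row0(2)[OF i] by (auto simp: filter_id_conv)
    then show "map (filter (\<lambda>e. e \<le> L)) T ! i = T0 ! i" using i lens Ti[OF i] by simp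
  qed
  ultimately show ?thesis by blast
qed

text \<open>A row is its part below the largest letter, filled up to the prescribed length; this
  gives injectivity. For surjectivity, the number of cells filled in is \<open>m\<close> because the
  sizes of the two shapes differ by \<open>m\<close>.\<close>

lemma bij_ptab_content:
  assumes lam: "sorted_wrt (\<ge>) lam"
  shows "bij_betw (map (filter (\<lambda>e. e \<le> length c))) (ptab_content (m # c) lam)
    (\<Union>mu\<in>strips (length c) m lam. ptab_content c mu)" (is "bij_betw ?f ?A ?B")
proof -
  let ?L = "length c"
  have cnt: "count_list (concat (?f T)) (Suc e) = count_list (concat T) (Suc e)" if "e < ?L" for e T
    using that count_list_filter[of "\<lambda>e. e \<le> ?L" "Suc e" "concat T"] by (simp add: filter_concat)
  have A: "T \<in> ?A \<longleftrightarrow> T \<in> ptab (Suc ?L) lam \<and> count_list (concat T) (Suc ?L) = m \<and>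
      (\<forall>e<?L. count_list (concat T) (Suc e) = rev c ! e)" for T
    by (auto simp: ptab_content_def less_Suc_eq nth_append)
  have "inj_on ?f ?A"
  proof (rule inj_onI)
    fix T T' assume h: "T \<in> ?A" "T' \<in> ?A" "?f T = ?f T'"
    have p: "T \<in> ptab (Suc ?L) lam" "T' \<in> ptab (Suc ?L) lam" using h A by auto
    have l: "map length T = lam" "map length T' = lam" using p by (auto simp: ptab_def)
    then have ll: "length T = length lam" "length T' = length lam" by (metis length_map)+
    show "T = T'"
    proof (rule nth_equalityI)
      show "length T = length T'" using ll by simp
      fix i assume i: "i < length T"
      have m: "T ! i \<in> set T" "T' ! i \<in> set T'" using i ll by auto
      have s: "sorted (T ! i)" "sorted (T' ! i)"
        using ptab_rows(1)[OF p(1) m(1)] ptab_rows(1)[OF p(2) m(2)] by simp_all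
      have "set (T ! i) \<subseteq> {1..Suc ?L}" "set (T' ! i) \<subseteq> {1..Suc ?L}"
        using ptab_rows(2)[OF p(1) m(1)] ptab_rows(2)[OF p(2) m(2)] by simp_all
      then have u': "set (T ! i) \<subseteq> {..Suc ?L}" "set (T' ! i) \<subseteq> {..Suc ?L}" by auto
      have "length (T ! i) = length (T' ! i)" using l i ll by (metis nth_map)
      moreover have "filter (\<lambda>e. e \<le> ?L) (T ! i) = filter (\<lambda>e. e \<le> ?L) (T' ! i)"
        using arg_cong[OF h(3), of "\<lambda>X. X ! i"] i ll by simp
      ultimately show "T ! i = T' ! i"
        using sorted_row_split[OF s(1) u'(1)] sorted_row_split[OF s(2) u'(2)] by metis
    qed
  qed
  moreover have "?f T \<in> ?B" if "T \<in> ?A" for T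
  proof -
    have T: "T \<in> ptab (Suc ?L) lam" "count_list (concat T) (Suc ?L) = m"
      "\<forall>e<?L. count_list (concat T) (Suc e) = rev c ! e" using that A by auto
    then have "?f T \<in> ptab_content c (map length (?f T))"
      using ptab_restrict(1)[OF T(1) lam] cnt by (simp add: ptab_content_def)
    then show ?thesis using ptab_restrict(2)[OF T(1) lam] T(2) by blast
  qed
  moreover have "T0 \<in> ?f ` ?A" if "T0 \<in> ?B" for T0
  proof -
    obtain mu where mu: "mu \<in> strips ?L m lam" "T0 \<in> ptab ?L mu"
      "\<forall>e<?L. count_list (concat T0) (Suc e) = rev c ! e"
      using \<open>T0 \<in> ?B\<close> by (auto simp: ptab_content_def)
    obtain T where T: "T \<in> ptab (Suc ?L) lam" "?f T = T0" using ptab_extend[OF mu(2,1) lam] by blast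
    have "map length T0 = mu" using mu(2) by (simp add: ptab_def)
    moreover have "sum_list lam = sum_list (map length (?f T)) + count_list (concat T) (Suc ?L)"
      using ptab_restrict(2)[OF T(1) lam] by (simp add: strips_def)
    moreover have "sum_list lam = sum_list mu + m" using mu(1) by (simp add: strips_def)
    ultimately have "count_list (concat T) (Suc ?L) = m" using T(2) by simp
    moreover have "\<forall>e<?L. count_list (concat T) (Suc e) = rev c ! e"
      using mu(3) cnt[of _ T] T(2) by simp
    ultimately have "T \<in> ?A" using A T(1) by simp
    then show ?thesis using T(2) by blast
  qed
  ultimately show ?thesis unfolding bij_betw_def by blast
qed

section \<open>Equality of the two counts\<close>

lemma card_bij_UN:
  assumes "bij_betw f A (\<Union>i\<in>I. F i)" "finite I" "\<And>i. i \<in> I \<Longrightarrow> finite (F i)"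
    and "\<And>i j. i \<in> I \<Longrightarrow> j \<in> I \<Longrightarrow> i \<noteq> j \<Longrightarrow> F i \<inter> F j = {}"
  shows "finite A \<and> card A = (\<Sum>i\<in>I. card (F i))"
proof -
  have "finite (\<Union>i\<in>I. F i)" using assms by auto
  moreover have "card (\<Union>i\<in>I. F i) = (\<Sum>i\<in>I. card (F i))"
    using assms by (intro card_UN_disjoint) auto
  ultimately show ?thesis using assms(1) bij_betw_finite bij_betw_same_card by metis
qed

text \<open>Both numbers satisfy the same recursion over strips, and the unions are disjoint because
  a tableau or a word determines its shape. At the empty alphabet only the shape with all rows empty
  contributes, once on each side.\<close>

lemma card_ptab_content:
  "sorted_wrt (\<ge>) lam \<Longrightarrow> finite (ptab_content c lam) \<and> finite (lattice_content c lam) \<and>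
    card (ptab_content c lam) = card (lattice_content c lam)"
proof (induction c arbitrary: lam)
  case Nil
  have p: "T \<in> ptab_content [] lam \<longleftrightarrow> T = replicate (length lam) [] \<and> (\<forall>i<length lam. lam ! i = 0)" for T
  proof
    assume T: "T \<in> ptab_content [] lam"
    then have e: "map length T = lam" "\<forall>r\<in>set T. r = []" by (auto simp: ptab_content_def ptab_def)
    then have "\<forall>i<length lam. lam ! i = 0" by auto
    moreover have "T = replicate (length lam) []"
      using e by (intro replicate_eqI) auto
    ultimately show "T = replicate (length lam) [] \<and> (\<forall>i<length lam. lam ! i = 0)" by simp
  next
    assume "T = replicate (length lam) [] \<and> (\<forall>i<length lam. lam ! i = 0)"
    then show "T \<in> ptab_content [] lam"
      by (auto simp: ptab_content_def ptab_def intro!: nth_equalityI)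
  qed
  have q: "q \<in> lattice_content [] lam \<longleftrightarrow> q = [] \<and> (\<forall>i<length lam. lam ! i = 0)" for q
    by (auto simp: lattice_content_def lattice_word_def part_def fun_eq_iff)
  show ?case
  proof (cases "\<forall>i<length lam. lam ! i = 0")
    case True
    then have "ptab_content [] lam = {replicate (length lam) []}" "lattice_content [] lam = {[]}"
      using p q by auto
    then show ?thesis by simp
  next
    case False
    then have "ptab_content [] lam = {}" "lattice_content [] lam = {}"
      using p q by blast+
    then show ?thesis by simp
  qed
next
  case (Cons m c)
  let ?S = "strips (length c) m lam"
  have IH: "finite (ptab_content c mu)" "finite (lattice_content c mu)"
    "card (ptab_content c mu) = card (lattice_content c mu)" if "mu \<in> ?S" for mu
    using Cons.IH[of mu] that by (auto simp: strips_def)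
  have "ptab_content c mu \<inter> ptab_content c nu = {}" if "mu \<noteq> nu" for mu nu
    using that by (auto simp: ptab_content_def ptab_def)
  then have 1: "finite (ptab_content (m # c) lam) \<and>
      card (ptab_content (m # c) lam) = (\<Sum>mu\<in>?S. card (ptab_content c mu))"
    using IH by (intro card_bij_UN[OF bij_ptab_content[OF Cons.prems] finite_strips]) auto
  \<comment> \<open>A word determines its shape only up to trailing zeros; shapes in
    \<open>?S\<close> all have the length of \<open>lam\<close>.\<close>
  have "lattice_content c mu \<inter> lattice_content c nu = {}" if "mu \<in> ?S" "nu \<in> ?S" "mu \<noteq> nu" for mu nu
    using that part_inject[of mu nu] by (auto simp: lattice_content_def strips_def)
  then have 2: "finite (lattice_content (m # c) lam) \<and>
      card (lattice_content (m # c) lam) = (\<Sum>mu\<in>?S. card (lattice_content c mu))"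
    using IH by (intro card_bij_UN[OF bij_lattice_content[OF Cons.prems] finite_strips]) auto
  have "(\<Sum>mu\<in>?S. card (ptab_content c mu)) = (\<Sum>mu\<in>?S. card (lattice_content c mu))"
    using IH by (intro sum.cong) auto
  then show ?case using 1 2 by simp
qed

section \<open>Counting factorizations\<close>

text \<open>The largest letter comes first, so \<open>Y (Suc k)\<close>, which counts the unprimed
  letter, precedes \<open>X (Suc k)\<close>. For factorizations this is the nonnegative end of the
  last block.\<close>

fun weights :: "(nat \<Rightarrow> nat) \<Rightarrow> (nat \<Rightarrow> nat) \<Rightarrow> nat \<Rightarrow> nat list" where
  "weights X Y 0 = []"
| "weights X Y (Suc k) = Y (Suc k) # X (Suc k) # weights X Y k"

lemma length_weights [simp]: "length (weights X Y k) = 2 * k"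
  by (induction k) auto

lemma rev_weights_nth:
  "i < k \<Longrightarrow> rev (weights X Y k) ! (2 * i) = X (Suc i) \<and> rev (weights X Y k) ! Suc (2 * i) = Y (Suc i)"
proof (induction k)
  case (Suc k)
  show ?case
  proof (cases "i < k")
    case True
    then show ?thesis using Suc.IH by (simp add: nth_append)
  next
    case False
    then have "i = k" using Suc.prems by simp
    then show ?thesis by (simp add: nth_append)
  qed
qed simp

text \<open>Separates primed letters from unprimed ones: the index \<open>e\<close> stands for the
  letter \<open>Suc e\<close>, so even indices are primed.\<close>

lemma all_less_double: "(\<forall>e<2 * k. P e) \<longleftrightarrow> (\<forall>i<k. P (2 * i) \<and> P (Suc (2 * i)))" for k :: nat
proof (intro iffI allI impI)
  fix e assume h: "\<forall>i<k. P (2 * i) \<and> P (Suc (2 * i))" "e < 2 * k"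
  then have "e div 2 < k" by auto
  then have "P (2 * (e div 2)) \<and> P (Suc (2 * (e div 2)))" using h(1) by blast
  then show "P e" by (cases "even e") (auto elim!: evenE oddE)
qed auto

text \<open>Exponents are functions on all of \<open>nat\<close>, but every double weight vanishes
  outside \<open>1..k\<close>; other exponents have coefficient 0 on both sides.\<close>

definition supported :: "nat \<Rightarrow> (nat \<Rightarrow> nat) \<Rightarrow> bool" where
  "supported k X \<longleftrightarrow> (\<forall>i. \<not> (1 \<le> i \<and> i \<le> k) \<longrightarrow> X i = 0)"

lemma supported_eq_iff:
  assumes "supported k X"
  shows "X = Y \<longleftrightarrow> supported k Y \<and> (\<forall>i<k. X (Suc i) = Y (Suc i))"
proof
  assume h: "supported k Y \<and> (\<forall>i<k. X (Suc i) = Y (Suc i))"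
  show "X = Y"
  proof
    fix i show "X i = Y i"
    proof (cases "1 \<le> i \<and> i \<le> k")
      case True
      then obtain j where "i = Suc j" "j < k" by (cases i) auto
      then show ?thesis using h by simp
    next
      case False
      then show ?thesis using h assms unfolding supported_def by metis
    qed
  qed
qed (use assms in auto)

lemma primed_tableaux_ptab: "primed_tableaux k lam = ptab (2 * k) lam"
  by (simp add: primed_tableaux_def ptab_def)

lemma wt_ptab:
  assumes "T \<in> ptab (2 * k) lam"
  shows "supported k (wtX T)" "supported k (wtY T)"
    and "wtX T (Suc i) = count_list (concat T) (Suc (2 * i))"
    and "wtY T (Suc i) = count_list (concat T) (Suc (Suc (2 * i)))"
proof -
  have "set (concat T) \<subseteq> {1..2 * k}" using assms by (fastforce simp: ptab_def)
  then have le: "e \<le> 2 * k" if "e \<in> set (concat T)" for e using that by auto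
  have "filter (\<lambda>e. e = 2 * i - 1) (concat T) = []" "filter (\<lambda>e. e = 2 * i) (concat T) = []"
    if "k < i" for i
    using le that by (force simp: filter_empty_conv)+
  then show "supported k (wtX T)" "supported k (wtY T)"
    by (auto simp: supported_def wtX_def wtY_def)
  have eq: "(\<lambda>e. e = a) = (=) a" for a :: nat by auto
  show "wtX T (Suc i) = count_list (concat T) (Suc (2 * i))"
    by (simp add: wtX_def count_list_eq_length_filter eq)
  show "wtY T (Suc i) = count_list (concat T) (Suc (Suc (2 * i)))"
    by (simp add: wtY_def count_list_eq_length_filter eq)
qed

lemma R_eq:
  "R k lam (X, Y) =
    (if supported k X \<and> supported k Y then card (ptab_content (weights X Y k) lam) else 0)"
proof -
  have "{T \<in> primed_tableaux k lam. wtX T = X \<and> wtY T = Y} =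
    (if supported k X \<and> supported k Y then ptab_content (weights X Y k) lam else {})"
  proof -
    have "wtX T = X \<and> wtY T = Y \<longleftrightarrow> supported k X \<and> supported k Y \<and>
        (\<forall>e<2 * k. count_list (concat T) (Suc e) = rev (weights X Y k) ! e)"
      if T: "T \<in> ptab (2 * k) lam" for T
      unfolding supported_eq_iff[OF wt_ptab(1)[OF T]] supported_eq_iff[OF wt_ptab(2)[OF T]]
        all_less_double
      using rev_weights_nth[of _ k X Y] wt_ptab(3,4)[OF T] by auto
    then show ?thesis by (auto simp: primed_tableaux_ptab ptab_content_def)
  qed
  then show ?thesis by (simp add: R_def)
qed

section \<open>Blocks as pairs of monotone runs\<close>

lemma sorted_block_split:
  assumes "sorted_wrt (<) (b :: int list)"
  shows "b = filter (\<lambda>a. a < 0) b @ filter (\<lambda>a. 0 \<le> a) b"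
  using assms
proof (induction b)
  case (Cons a b)
  then show ?case
  proof (cases "a < 0")
    case False
    then have "filter (\<lambda>a. a < 0) b = []" using Cons.prems by (fastforce simp: filter_empty_conv)
    moreover have "filter (\<lambda>a. 0 \<le> a) b = b" using Cons.prems False by (fastforce simp: filter_id_conv)
    ultimately show ?thesis using False by simp
  qed simp
qed simp

lemma map_abs_block:
  assumes "sorted_wrt (<) (b :: int list)"
  shows "map abs b = map uminus (filter (\<lambda>a. a < 0) b) @ filter (\<lambda>a. 0 \<le> a) b"
proof -
  have "map abs (filter (\<lambda>a. a < 0) b) = map uminus (filter (\<lambda>a. a < 0) b)"
    "map abs (filter (\<lambda>a. 0 \<le> a) b) = filter (\<lambda>a. 0 \<le> a) b"
    by (auto intro: map_idI)
  then show ?thesis using arg_cong[OF sorted_block_split[OF assms], of "map abs"] by simp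
qed

definition blocks :: "(nat \<Rightarrow> nat) \<Rightarrow> (nat \<Rightarrow> nat) \<Rightarrow> nat \<Rightarrow> int list list set" where
  "blocks X Y k = {bs. length bs = k \<and> (\<forall>b\<in>set bs. sorted_wrt (<) b) \<and> 0 \<notin> set (concat bs) \<and>
    (\<forall>i<k. length (filter (\<lambda>a. a < 0) (bs ! i)) = X (Suc i) \<and>
           length (filter (\<lambda>a. 0 \<le> a) (bs ! i)) = Y (Suc i))}"

lemma blocks_0: "blocks X Y 0 = {[]}"
  by (auto simp: blocks_def)

lemma blocks_Suc:
  "bs \<in> blocks X Y (Suc k) \<longleftrightarrow> (\<exists>bs' b. bs = bs' @ [b] \<and> bs' \<in> blocks X Y k \<and> sorted_wrt (<) b \<and>
    0 \<notin> set b \<and> length (filter (\<lambda>a. a < 0) b) = X (Suc k) \<and> length (filter (\<lambda>a. 0 \<le> a) b) = Y (Suc k))"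
  by (cases bs rule: rev_cases) (auto simp: blocks_def less_Suc_eq nth_append)

text \<open>One block contributes two segments. As \<open>weights X Y k\<close> has even length, the
  one counted by \<open>X\<close> falls under \<open>P\<close> and the one counted by
  \<open>Y\<close> under \<open>Q\<close>.\<close>

lemma alt_weights_Suc:
  "alt P Q (weights X Y (Suc k)) w \<longleftrightarrow> (\<exists>u v v'. w = u @ v @ v' \<and> alt P Q (weights X Y k) u \<and>
    length v = X (Suc k) \<and> length v' = Y (Suc k) \<and> successively P v \<and> successively Q v')"
    (is "?l \<longleftrightarrow> ?r")
proof
  assume ?l
  then obtain u1 v' where 1: "w = u1 @ v'" "length v' = Y (Suc k)" "successively Q v'"
    "alt P Q (X (Suc k) # weights X Y k) u1" by auto
  then obtain u v where "u1 = u @ v" "length v = X (Suc k)" "successively P v"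
    "alt P Q (weights X Y k) u" by auto
  then show ?r using 1 append_assoc by blast
next
  assume ?r
  then obtain u v v' where 1: "w = (u @ v) @ v'" "alt P Q (weights X Y k) u"
    "length v = X (Suc k)" "length v' = Y (Suc k)" "successively P v" "successively Q v'" by auto
  then have "alt P Q (X (Suc k) # weights X Y k) (u @ v)" by auto
  then show ?l
    unfolding weights.simps alt.simps(2)[of P Q "Y (Suc k)"]
    using 1 by (intro exI[of _ "u @ v"] exI[of _ v'] conjI) simp_all
qed

lemma bij_betw_restrict:
  "bij_betw f A B \<Longrightarrow> bij_betw f {x \<in> A. f x \<in> S} {y \<in> B. y \<in> S}"
  by (auto simp: bij_betw_def inj_on_def)

text \<open>The lengths in \<open>X\<close> and \<open>Y\<close> tell where the blocks end and where
  signs change within a block, so the signs lost by \<open>abs\<close> can be restored. Negating a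
  decreasing positive run gives an increasing negative run, which fits before the positive
  one.\<close>

lemma bij_blocks:
  "bij_betw (\<lambda>bs. map abs (concat bs)) (blocks X Y k)
    {w. (\<forall>a\<in>set w. 0 < a) \<and> alt (>) (<) (weights X Y k) w}"
proof (induction k)
  case 0
  have "{w :: int list. (\<forall>a\<in>set w. 0 < a) \<and> alt (>) (<) (weights X Y 0) w} = {[]}" by auto
  then show ?case by (simp add: blocks_0 bij_betw_def)
next
  case (Suc k)
  let ?f = "\<lambda>bs :: int list list. map abs (concat bs)"
  let ?V = "\<lambda>k. {w :: int list. (\<forall>a\<in>set w. 0 < a) \<and> alt (>) (<) (weights X Y k) w}"
  let ?x = "X (Suc k)" and ?y = "Y (Suc k)"
  have V: "w \<in> ?V (Suc k) \<longleftrightarrow> (\<exists>u v v'. w = u @ v @ v' \<and> u \<in> ?V k \<and> (\<forall>a\<in>set (v @ v'). 0 < a) \<and>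
      length v = ?x \<and> length v' = ?y \<and> sorted_wrt (>) v \<and> sorted_wrt (<) v')" for w
  proof -
    have "successively (>) v \<longleftrightarrow> sorted_wrt (>) v" for v :: "int list"
      by (rule successively_conv_sorted_wrt) (auto intro: transpI)
    moreover have "(\<forall>a\<in>set (u @ v). 0 < a) \<longleftrightarrow> (\<forall>a\<in>set u. 0 < a) \<and> (\<forall>a\<in>set v. 0 < a)"
      for u v :: "int list" by auto
    ultimately show ?thesis
      unfolding mem_Collect_eq alt_weights_Suc successively_less by blast
  qed
  have "inj_on ?f (blocks X Y (Suc k))"
  proof (rule inj_onI)
    fix cs cs' assume h: "cs \<in> blocks X Y (Suc k)" "cs' \<in> blocks X Y (Suc k)" "?f cs = ?f cs'"
    obtain bs b where b: "cs = bs @ [b]" "bs \<in> blocks X Y k" "sorted_wrt (<) b"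
      "length (filter (\<lambda>a. a < 0) b) = ?x" "length (filter (\<lambda>a. 0 \<le> a) b) = ?y"
      using h(1) unfolding blocks_Suc by blast
    obtain bs' b' where b': "cs' = bs' @ [b']" "bs' \<in> blocks X Y k" "sorted_wrt (<) b'"
      "length (filter (\<lambda>a. a < 0) b') = ?x" "length (filter (\<lambda>a. 0 \<le> a) b') = ?y"
      using h(2) unfolding blocks_Suc by blast
    have m: "map abs b = map uminus (filter (\<lambda>a. a < 0) b) @ filter (\<lambda>a. 0 \<le> a) b"
      "map abs b' = map uminus (filter (\<lambda>a. a < 0) b') @ filter (\<lambda>a. 0 \<le> a) b'"
      using map_abs_block b(3) b'(3) by blast+
    then have "length (map abs b) = ?x + ?y" "length (map abs b') = ?x + ?y"
      using b b' by (metis length_append length_map)+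
    then have e: "?f bs = ?f bs'" "map abs b = map abs b'"
      using h(3) b(1) b'(1) by simp_all
    have "map uminus (filter (\<lambda>a. a < 0) b) = map uminus (filter (\<lambda>a. a < 0) b') \<and>
        filter (\<lambda>a. 0 \<le> a) b = filter (\<lambda>a. 0 \<le> a) b'"
      using e(2) b(4) b'(4) unfolding m by (simp add: append_eq_append_conv)
    moreover have "inj (map (uminus :: int \<Rightarrow> int))" by (simp add: inj_def)
    ultimately have "b = b'"
      using sorted_block_split[OF b(3)] sorted_block_split[OF b'(3)] by (metis injD)
    moreover have "bs = bs'" using Suc.IH e(1) b(2) b'(2) by (auto simp: bij_betw_def inj_on_def)
    ultimately show "cs = cs'" using b b' by simp
  qed
  moreover have "?f cs \<in> ?V (Suc k)" if "cs \<in> blocks X Y (Suc k)" for cs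
  proof -
    obtain bs b where b: "cs = bs @ [b]" "bs \<in> blocks X Y k" "sorted_wrt (<) b" "0 \<notin> set b"
      "length (filter (\<lambda>a. a < 0) b) = ?x" "length (filter (\<lambda>a. 0 \<le> a) b) = ?y"
      using \<open>cs \<in> blocks X Y (Suc k)\<close> unfolding blocks_Suc by blast
    let ?v = "map uminus (filter (\<lambda>a. a < 0) b)" and ?v' = "filter (\<lambda>a. 0 \<le> a) b"
    have "?f cs = ?f bs @ ?v @ ?v'" using map_abs_block[OF b(3)] b(1) by simp
    moreover have "?f bs \<in> ?V k"
      using Suc.IH imageI[OF b(2), of ?f] by (simp only: bij_betw_def)
    moreover have "\<forall>a\<in>set (?v @ ?v'). 0 < a" using b(4) by (auto simp: order_le_less)
    moreover have "length ?v = ?x" "length ?v' = ?y" using b by simp_all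
    moreover have "sorted_wrt (>) ?v" "sorted_wrt (<) ?v'"
      using b(3) by (simp_all add: sorted_wrt_map sorted_wrt_filter)
    ultimately show ?thesis unfolding V by blast
  qed
  moreover have "w \<in> ?f ` blocks X Y (Suc k)" if "w \<in> ?V (Suc k)" for w
  proof -
    obtain u v v' where w: "w = u @ v @ v'" "u \<in> ?V k" "\<forall>a\<in>set (v @ v'). 0 < a"
      "length v = ?x" "length v' = ?y" "sorted_wrt (>) v" "sorted_wrt (<) v'"
      using \<open>w \<in> ?V (Suc k)\<close> unfolding V by blast
    have "u \<in> ?f ` blocks X Y k" using Suc.IH w(2) by (simp only: bij_betw_def)
    then obtain bs where bs: "bs \<in> blocks X Y k" "?f bs = u" by (elim imageE) simp
    let ?b = "map uminus v @ v'"
    have "- a < a'" if "a \<in> set v" "a' \<in> set v'" for a a'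
    proof -
      have "0 < a" "0 < a'" using that w(3) by auto
      then show ?thesis by simp
    qed
    then have sb: "sorted_wrt (<) ?b" using w(6,7) by (simp add: sorted_wrt_append sorted_wrt_map)
    have nz: "0 \<notin> set ?b" using w(3) by auto
    have pos: "0 < a" if "a \<in> set v'" for a using that w(3) by simp
    have neg: "a < 0" if "a \<in> set (map uminus v)" for a
    proof -
      obtain x where "x \<in> set v" "a = - x" using \<open>a \<in> set (map uminus v)\<close> by auto
      then show ?thesis using w(3) by simp
    qed
    have "filter (\<lambda>a. a < 0) (map uminus v) = map uminus v" "filter (\<lambda>a. 0 \<le> a) v' = v'"
      unfolding filter_id_conv using neg pos less_imp_le by blast+
    moreover have "filter (\<lambda>a. a < 0) v' = []" "filter (\<lambda>a. 0 \<le> a) (map uminus v) = []"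
      unfolding filter_empty_conv using neg pos less_asym leD by blast+
    ultimately have "filter (\<lambda>a. a < 0) ?b = map uminus v" "filter (\<lambda>a. 0 \<le> a) ?b = v'"
      by (simp_all only: filter_append append_Nil append_Nil2)
    then have "bs @ [?b] \<in> blocks X Y (Suc k)"
      unfolding blocks_Suc using bs(1) w(4,5) sb nz by auto
    moreover have id: "\<bar>a\<bar> = a" if "a \<in> set (v @ v')" for a
      using bspec[OF w(3) that] by simp
    have "map (abs \<circ> uminus) v = v" "map abs v' = v'"
      by (rule map_idI, use id in simp)+
    then have "?f (bs @ [?b]) = w" using bs(2) w(1) by simp
    ultimately show ?thesis by blast
  qed
  ultimately show ?case unfolding bij_betw_def by blast
qed

section \<open>Grouping reduced words by their Edelman--Greene tableau\<close>

lemma rowlen_part: "rowlen T = part (map length T)"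
proof
  fix i show "rowlen T i = part (map length T) i"
    by (induction T i rule: rowlen.induct) (auto simp: part_def)
qed

lemma tab_iff:
  "tab T \<longleftrightarrow> young_shape T \<and> (\<forall>r\<in>set T. sorted_wrt (<) r) \<and>
    (\<forall>i j. Suc i < length T \<and> j < length (T ! Suc i) \<longrightarrow> T ! i ! j < T ! Suc i ! j)"
proof (induction T)
  case Nil
  then show ?case by (simp add: young_shape_def)
next
  case (Cons r T)
  have len: "(\<forall>s\<in>set T. length s \<le> length r) \<longleftrightarrow> length (first T) \<le> length r" if "young_shape T"
    using that by (cases T) (auto simp: young_shape_def)
  have col: "(\<forall>i j. Suc i < length (r # T) \<and> j < length ((r # T) ! Suc i) \<longrightarrow>
        (r # T) ! i ! j < (r # T) ! Suc i ! j) \<longleftrightarrow>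
      (\<forall>j<length (first T). r ! j < first T ! j) \<and>
      (\<forall>i j. Suc i < length T \<and> j < length (T ! Suc i) \<longrightarrow> T ! i ! j < T ! Suc i ! j)"
    (is "?l \<longleftrightarrow> ?r")
  proof
    assume h: ?l
    have "\<forall>j<length (first T). r ! j < first T ! j" using h[rule_format, of 0] by (cases T) auto
    moreover have "\<forall>i j. Suc i < length T \<and> j < length (T ! Suc i) \<longrightarrow> T ! i ! j < T ! Suc i ! j"
      using h[rule_format, of "Suc _"] by simp
    ultimately show ?r by blast
  next
    assume h: ?r
    show ?l
    proof (intro allI impI)
      fix i j assume "Suc i < length (r # T) \<and> j < length ((r # T) ! Suc i)"
      then show "(r # T) ! i ! j < (r # T) ! Suc i ! j"
        using h by (cases i; cases T) auto
    qed
  qed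
  have "young_shape (r # T) \<longleftrightarrow> r \<noteq> [] \<and> young_shape T \<and> (\<forall>s\<in>set T. length s \<le> length r)"
    by (auto simp: young_shape_def)
  then show ?case
    unfolding col tab.simps Cons.IH using len by (auto simp: below_def)
qed

lemma EG_iff:
  "T \<in> EG n \<omega> \<longleftrightarrow> tab T \<and> set (concat T) \<subseteq> {1..int n} \<and> concat (rev T) \<in> reduced_words \<omega>"
  unfolding EG_def tab_iff by auto

text \<open>Reduced words of one element share their length, which bounds the number and the length
  of the rows. Finiteness matters because a sum over an infinite set is 0 by convention.\<close>

lemma finite_EG:
  assumes "\<omega> = W_elem n w"
  shows "finite (EG n \<omega>)"
proof (cases "EG n \<omega> = {}")
  case False
  then obtain T0 where T0: "T0 \<in> EG n \<omega>" by blast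
  define N where "N = length (concat (rev T0))"
  let ?rows = "{r. set r \<subseteq> {1..int n} \<and> length r \<le> N}"
  have "T \<in> {T. set T \<subseteq> ?rows \<and> length T \<le> N}" if T: "T \<in> EG n \<omega>" for T
  proof -
    have "length (concat (rev T)) \<le> N"
      using T T0 by (auto simp: EG_iff reduced_words_def N_def)
    then have N: "sum_list (map length T) \<le> N" by (simp add: length_concat rev_map[symmetric])
    have "length r \<le> N" if "r \<in> set T" for r
      using member_le_sum_list[of "length r" "map length T"] that N by simp
    moreover have "length T \<le> sum_list (map length T)"
    proof -
      have "\<forall>r\<in>set T. r \<noteq> []" using T by (simp add: EG_def young_shape_def)
      then show ?thesis
      proof (induction T)
        case (Cons r T)
        then show ?case by (cases r) auto
      qed simp
    qed
    moreover have "\<forall>r\<in>set T. set r \<subseteq> {1..int n}" using T by (simp add: EG_def)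
    ultimately show ?thesis using N by auto
  qed
  moreover have "finite ?rows" by (rule finite_lists_length_le) simp
  then have "finite {T. set T \<subseteq> ?rows \<and> length T \<le> N}" by (rule finite_lists_length_le)
  ultimately show ?thesis by (meson finite_subset subsetI)
qed simp

text \<open>Both directions are instances of \<open>alt_transfer\<close>, because
  \<open>egr_descents_red\<close> gives equivalences.\<close>

lemma egr_red_alt_iff:
  assumes "egr w T q" "red n w"
  shows "alt (>) (<) c w \<longleftrightarrow> alt (<) (\<ge>) c q"
proof -
  have len: "length w = length q" using egr_length[OF assms(1)] .
  show ?thesis
    using alt_transfer[of "(>)" "(<)" c w q "(<)" "(\<ge>)"] alt_transfer[of "(<)" "(\<ge>)" c q w "(>)" "(<)"]
      egr_descents_red[OF assms(1) _ assms(2)] len by auto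
qed

text \<open>The words with a given insertion tableau are numbered by their recording words, which
  range over all lattice words of its shape with the required runs; different tableaux share no
  word, by \<open>egr_det_forward\<close>.\<close>

lemma card_reduced_words_alt:
  assumes \<omega>: "\<omega> = W_elem n w0"
  shows "card {w \<in> reduced_words \<omega>. set w \<subseteq> {1..int n} \<and> alt (>) (<) c w} =
    (\<Sum>T\<in>EG n \<omega>. card (lattice_content c (shape T)))"
proof -
  let ?F = "\<lambda>T. {w. \<exists>q\<in>lattice_content c (shape T). egr w T q}"
  have T: "sorted_wrt (\<ge>) (shape T)" "red n (concat (rev T))" "rowlen T = part (shape T)"
    if "T \<in> EG n \<omega>" for T
    using that by (auto simp: EG_def young_shape_def shape_def rowlen_part \<omega> mem_reduced_words)
  have fin: "finite (lattice_content c (shape T))" if "T \<in> EG n \<omega>" for T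
    using card_ptab_content T(1)[OF that] by blast
  have bij: "finite (?F T) \<and> card (?F T) = card (lattice_content c (shape T))" if E: "T \<in> EG n \<omega>" for T
  proof -
    have ex: "\<exists>w. egr w T q" if "q \<in> lattice_content c (shape T)" for q
      using egr_exists_backward[of T n q] that E T[OF E] by (auto simp: EG_iff lattice_content_def)
    define g where "g q = (SOME w. egr w T q)" for q
    have g: "egr (g q) T q" if "q \<in> lattice_content c (shape T)" for q
      unfolding g_def using ex[OF that] by (rule someI_ex)
    have "bij_betw g (lattice_content c (shape T)) (?F T)"
    proof (rule bij_betwI')
      fix q q' assume "q \<in> lattice_content c (shape T)" "q' \<in> lattice_content c (shape T)"
      then show "g q = g q' \<longleftrightarrow> q = q'" using g egr_det_forward by metis
    next
      fix q assume "q \<in> lattice_content c (shape T)"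
      then show "g q \<in> ?F T" using g by blast
    next
      fix w assume "w \<in> ?F T"
      then show "\<exists>q\<in>lattice_content c (shape T). w = g q" using g egr_det_backward by blast
    qed
    then show ?thesis using fin[OF E] bij_betw_finite[of g] bij_betw_same_card[of g] by simp
  qed
  have "{w \<in> reduced_words \<omega>. set w \<subseteq> {1..int n} \<and> alt (>) (<) c w} = (\<Union>T\<in>EG n \<omega>. ?F T)"
  proof (intro equalityI subsetI)
    fix w assume "w \<in> {w \<in> reduced_words \<omega>. set w \<subseteq> {1..int n} \<and> alt (>) (<) c w}"
    then have w: "wequiv n w0 w" "red n w" "set w \<subseteq> {1..int n}" "alt (>) (<) c w"
      by (auto simp: \<omega> mem_reduced_words)
    obtain T q where e: "egr w T q" using egr_exists_forward w by blast
    have p: "tab T" "wequiv n w (concat (rev T))" "set (concat T) = set w"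
      "rowlen T = count_list q" "lattice_word q"
      using egr_props[OF e w(3)] by auto
    have "length (concat (rev T)) = length w" using egr_length_reading[OF e] .
    then have "red n (concat (rev T))" using red_wequiv[OF w(2) p(2)] by simp
    then have "T \<in> EG n \<omega>"
      using p w wequiv_trans[OF w(1) p(2)] by (simp add: EG_iff \<omega> mem_reduced_words)
    moreover have "q \<in> lattice_content c (shape T)"
      using p w(4) egr_red_alt_iff[OF e w(2)] by (simp add: lattice_content_def shape_def rowlen_part)
    ultimately show "w \<in> (\<Union>T\<in>EG n \<omega>. ?F T)" using e by blast
  next
    fix w assume "w \<in> (\<Union>T\<in>EG n \<omega>. ?F T)"
    then obtain T q where e: "T \<in> EG n \<omega>" "q \<in> lattice_content c (shape T)" "egr w T q" by blast
    have w: "set w \<subseteq> {1..int n}" using e(1) egr_set[OF e(3)] by (metis EG_iff)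
    then have p: "wequiv n w (concat (rev T))" using egr_props[OF e(3)] by blast
    have "length (concat (rev T)) = length w" using egr_length_reading[OF e(3)] .
    then have "red n w" using red_wequiv[OF T(2)[OF e(1)] wequiv_sym[OF p]] by simp
    moreover have "wequiv n w0 (concat (rev T))" using e(1) by (simp add: EG_iff \<omega> mem_reduced_words)
    then have "wequiv n w0 w" using wequiv_sym[OF p] wequiv_trans by blast
    moreover have "alt (>) (<) c w"
      using egr_red_alt_iff[OF e(3) \<open>red n w\<close>] e(2) by (simp add: lattice_content_def)
    ultimately show "w \<in> {w \<in> reduced_words \<omega>. set w \<subseteq> {1..int n} \<and> alt (>) (<) c w}"
      using w by (simp add: \<omega> mem_reduced_words)
  qed
  moreover have "card (\<Union>T\<in>EG n \<omega>. ?F T) = (\<Sum>T\<in>EG n \<omega>. card (?F T))"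
    using finite_EG[OF \<omega>] bij egr_det_forward by (intro card_UN_disjoint) blast+
  ultimately show ?thesis using bij by simp
qed

lemma Fd_eq:
  assumes w: "set w \<subseteq> {1..int n}" and \<omega>: "\<omega> = W_elem n w"
  shows "Fd k \<omega> (X, Y) = (if supported k X \<and> supported k Y
    then card {w \<in> reduced_words \<omega>. set w \<subseteq> {1..int n} \<and> alt (>) (<) (weights X Y k) w} else 0)"
proof -
  let ?f = "\<lambda>bs :: int list list. map abs (concat bs)"
  have dw: "dw1 bs = X \<and> dw2 bs = Y \<longleftrightarrow> supported k X \<and> supported k Y \<and>
      (\<forall>i<k. length (filter (\<lambda>a. a < 0) (bs ! i)) = X (Suc i) \<and>
             length (filter (\<lambda>a. 0 \<le> a) (bs ! i)) = Y (Suc i))" if "length bs = k" for bs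
  proof -
    have s: "supported k (dw1 bs)" "supported k (dw2 bs)"
      using that by (auto simp: supported_def dw1_def dw2_def)
    show ?thesis
      unfolding supported_eq_iff[OF s(1)] supported_eq_iff[OF s(2)]
      using that by (auto simp: dw1_def dw2_def)
  qed
  show ?thesis
  proof (cases "supported k X \<and> supported k Y")
    case False
    then have "{bs \<in> RSIF k \<omega>. dw1 bs = X \<and> dw2 bs = Y} = {}"
      using dw by (auto simp: RSIF_def)
    then have "Fd k \<omega> (X, Y) = 0" by (simp only: Fd_def prod.case card.empty)
    then show ?thesis by (simp only: False if_False)
  next
    case True
    have red: "concat bs \<in> reduced_words \<omega> \<longleftrightarrow> 0 \<notin> set (concat bs) \<and> ?f bs \<in> reduced_words \<omega>" for bs
    proof -
      have "set (concat bs) \<subseteq> letters n" if "?f bs \<in> reduced_words \<omega>"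
      proof
        fix a assume "a \<in> set (concat bs)"
        then have "\<bar>a\<bar> \<in> set (?f bs)" unfolding set_map by (rule imageI)
        moreover have "set (?f bs) \<subseteq> letters n" using that by (simp only: \<omega> mem_reduced_words red_def)
        ultimately have "\<bar>a\<bar> \<in> letters n" by blast
        then show "a \<in> letters n" by (auto simp: letters_def)
      qed
      then show ?thesis using mem_reduced_words_iff_abs[OF w, of "concat bs"] \<omega> by blast
    qed
    let ?V = "{w :: int list. (\<forall>a\<in>set w. 0 < a) \<and> alt (>) (<) (weights X Y k) w}"
    have "bs \<in> RSIF k \<omega> \<and> dw1 bs = X \<and> dw2 bs = Y \<longleftrightarrow>
        bs \<in> blocks X Y k \<and> ?f bs \<in> reduced_words \<omega>" for bs
      unfolding RSIF_def blocks_def mem_Collect_eq using red[of bs] dw[of bs] True by blast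
    then have "{bs \<in> RSIF k \<omega>. dw1 bs = X \<and> dw2 bs = Y} = {bs \<in> blocks X Y k. ?f bs \<in> reduced_words \<omega>}"
      by blast
    moreover have "card {bs \<in> blocks X Y k. ?f bs \<in> reduced_words \<omega>} = card {w \<in> ?V. w \<in> reduced_words \<omega>}"
      by (rule bij_betw_same_card[OF bij_betw_restrict[OF bij_blocks]])
    moreover have "set w \<subseteq> letters n" if "w \<in> reduced_words \<omega>" for w
      using that by (simp add: \<omega> mem_reduced_words red_def)
    then have "{w \<in> ?V. w \<in> reduced_words \<omega>} =
        {w \<in> reduced_words \<omega>. set w \<subseteq> {1..int n} \<and> alt (>) (<) (weights X Y k) w}"
      by (fastforce simp: letters_def)
    ultimately have "Fd k \<omega> (X, Y) =
        card {w \<in> reduced_words \<omega>. set w \<subseteq> {1..int n} \<and> alt (>) (<) (weights X Y k) w}"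
      by (simp only: Fd_def prod.case)
    then show ?thesis using True by simp
  qed
qed

theorem theorem2p2:
  fixes n :: nat and \<omega> :: "int list set"
  assumes "in_A n \<omega>"
  shows "\<forall>k. Fd k \<omega> = (\<lambda>m. \<Sum>T\<in>EG n \<omega>. R k (shape T) m)"
proof (intro allI ext)
  fix k and m :: "(nat \<Rightarrow> nat) \<times> (nat \<Rightarrow> nat)"
  obtain X Y where m: "m = (X, Y)" by (cases m)
  obtain w where w: "set w \<subseteq> {1..int n}" "\<omega> = W_elem n w"
    using assms by (auto simp: in_A_def)
  show "Fd k \<omega> m = (\<Sum>T\<in>EG n \<omega>. R k (shape T) m)"
  proof (cases "supported k X \<and> supported k Y")
    case True
    let ?c = "weights X Y k"
    have "Fd k \<omega> m = (\<Sum>T\<in>EG n \<omega>. card (lattice_content ?c (shape T)))"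
      unfolding m Fd_eq[OF w] card_reduced_words_alt[OF w(2)] using True by simp
    also have "\<dots> = (\<Sum>T\<in>EG n \<omega>. R k (shape T) m)"
    proof (rule sum.cong)
      fix T assume "T \<in> EG n \<omega>"
      then have "sorted_wrt (\<ge>) (shape T)" by (simp add: EG_def young_shape_def shape_def)
      then show "card (lattice_content ?c (shape T)) = R k (shape T) m"
        using card_ptab_content[of "shape T" ?c] True by (simp add: m R_eq)
    qed simp
    finally show ?thesis .
  next
    case False
    then show ?thesis by (simp only: m Fd_eq[OF w] R_eq if_False sum.neutral_const)
  qed
qed

end
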